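(* Let $(\mathfrak{L},\cdot,[\cdot,\cdot])$ be a complex transposed Poisson algebra (not necessarily unital). Then the Kantor double of $(\mathfrak{L},\cdot,[\cdot,\cdot])$ is a Jordan superalgebra.
   Context: A transposed Poisson algebra is a triple $(\mathfrak{L},\cdot,[\cdot,\cdot])$ consisting of a vector space with two nonzero bilinear operations such that $(\mathfrak{L},\cdot)$ is a commutative associative algebra, $(\mathfrak{L},[\cdot,\cdot])$ is a Lie algebra, and $2z\cdot[x,y]=[z\cdot x,y]+[x,z\cdot y]$ for all $x,y,z\in\mathfrak{L}$. Let $(\mathbf{A},\cdot)$ be a commutative associative algebra and $\{\cdot,\cdot\}$ an anticommutative bilinear product on $\mathbf{A}$. The Kantor double of $(\mathbf{A},\cdot,\{\cdot,\cdot\})$ is the superalgebra $J=\mathbf{A}\oplus\mathbf{A}x$, with even part $\mathbf{A}$ and odd part $\mathbf{A}x$ (a copy of the vector space $\mathbf{A}$), and multiplication $$a\ast b=a\cdot b,\quad a\ast(bx)=(a\cdot b)x,\quad (ax)\ast b=(a\cdot b)x,\quad (ax)\ast(bx)=\{a,b\}\qquad(a,b\in\mathbf{A}).$$ A superalgebra $J=J_0\oplus J_1$ is a Jordan superalgebra if its Grassmann envelope $G_0\otimes J_0+G_1\otimes J_1$ (with $G=G_0\oplus G_1$ the Grassmann algebra on countably many generators) is a Jordan algebra, i.e. is commutative and satisfies $(u^2v)u=u^2(vu)$. *)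

theory Defs
  imports Complex_Main "HOL-Library.FSet" "HOL-Library.Poly_Mapping" "HOL-Library.Product_Plus"
begin

section \<open>Algebras with a bilinear product\<close>

text \<open>Not assumed associative, commutative or unital; the algebra lives on a subspace \<open>A\<close>
  of the ambient vector space.\<close>

locale algebra_on = vector_space scale
  for scale :: "'f::field \<Rightarrow> 'v::ab_group_add \<Rightarrow> 'v" +
  fixes A :: "'v set" and mult :: "'v \<Rightarrow> 'v \<Rightarrow> 'v"
  assumes carrier_subspace: "subspace A"
    and mult_closed: "\<lbrakk>x \<in> A; y \<in> A\<rbrakk> \<Longrightarrow> mult x y \<in> A"
    and mult_add_left: "\<lbrakk>x \<in> A; y \<in> A; z \<in> A\<rbrakk> \<Longrightarrow> mult (x + y) z = mult x z + mult y z"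
    and mult_add_right: "\<lbrakk>x \<in> A; y \<in> A; z \<in> A\<rbrakk> \<Longrightarrow> mult x (y + z) = mult x y + mult x z"
    and mult_scale_left: "\<lbrakk>x \<in> A; y \<in> A\<rbrakk> \<Longrightarrow> mult (scale c x) y = scale c (mult x y)"
    and mult_scale_right: "\<lbrakk>x \<in> A; y \<in> A\<rbrakk> \<Longrightarrow> mult x (scale c y) = scale c (mult x y)"

locale comm_assoc_algebra = algebra_on scale UNIV mult
  for scale :: "'f::field \<Rightarrow> 'v::ab_group_add \<Rightarrow> 'v" and mult :: "'v \<Rightarrow> 'v \<Rightarrow> 'v" +
  assumes commute: "mult x y = mult y x"
    and assoc: "mult (mult x y) z = mult x (mult y z)"

locale lie_algebra = algebra_on scale UNIV bracket
  for scale :: "'f::field \<Rightarrow> 'v::ab_group_add \<Rightarrow> 'v" and bracket :: "'v \<Rightarrow> 'v \<Rightarrow> 'v" +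
  assumes alternating: "bracket x x = 0"
    and jacobi: "bracket x (bracket y z) + bracket y (bracket z x) + bracket z (bracket x y) = 0"

locale transposed_poisson_algebra =
  comm_assoc_algebra scale dot + lie_algebra scale bracket
  for scale :: "'f::field \<Rightarrow> 'v::ab_group_add \<Rightarrow> 'v"
    and dot :: "'v \<Rightarrow> 'v \<Rightarrow> 'v" and bracket :: "'v \<Rightarrow> 'v \<Rightarrow> 'v" +
  assumes dot_nonzero: "\<exists>x y. dot x y \<noteq> 0"
    and bracket_nonzero: "\<exists>x y. bracket x y \<noteq> 0"
    and transposed_leibniz:
      "scale 2 (dot z (bracket x y)) = bracket (dot z x) y + bracket x (dot z y)"

locale jordan_algebra_on = algebra_on scale A mult
  for scale :: "'f::field \<Rightarrow> 'v::ab_group_add \<Rightarrow> 'v" and A :: "'v set"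
    and mult :: "'v \<Rightarrow> 'v \<Rightarrow> 'v" +
  assumes jordan_commute: "\<lbrakk>u \<in> A; v \<in> A\<rbrakk> \<Longrightarrow> mult u v = mult v u"
    and jordan_identity:
      "\<lbrakk>u \<in> A; v \<in> A\<rbrakk> \<Longrightarrow> mult (mult (mult u u) v) u = mult (mult u u) (mult v u)"

locale superalgebra = algebra_on scale UNIV mult
  for scale :: "'f::field \<Rightarrow> 'v::ab_group_add \<Rightarrow> 'v" and mult :: "'v \<Rightarrow> 'v \<Rightarrow> 'v"
    and J0 :: "'v set" and J1 :: "'v set" +
  assumes even_subspace: "subspace J0"
    and odd_subspace: "subspace J1"
    and decomposition: "\<exists>a\<in>J0. \<exists>b\<in>J1. x = a + b"
    and independent_parts: "J0 \<inter> J1 = {0}"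
    and even_even: "\<lbrakk>x \<in> J0; y \<in> J0\<rbrakk> \<Longrightarrow> mult x y \<in> J0"
    and even_odd: "\<lbrakk>x \<in> J0; y \<in> J1\<rbrakk> \<Longrightarrow> mult x y \<in> J1"
    and odd_even: "\<lbrakk>x \<in> J1; y \<in> J0\<rbrakk> \<Longrightarrow> mult x y \<in> J1"
    and odd_odd: "\<lbrakk>x \<in> J1; y \<in> J1\<rbrakk> \<Longrightarrow> mult x y \<in> J0"


section \<open>The Grassmann algebra on countably many generators\<close>

text \<open>
  The generators are \<open>e\<^sub>0, e\<^sub>1, \<dots>\<close>, and the finite set \<open>S = {i\<^sub>1 < \<dots> < i\<^sub>k}\<close> stands for the basis
  monomial \<open>e\<^sub>S = e\<^bsub>i\<^sub>1\<^esub> \<dots> e\<^bsub>i\<^sub>k\<^esub>\<close>, with \<open>e\<^bsub>{}\<^esub> = 1\<close>.  Sorting \<open>e\<^sub>S e\<^sub>T\<close> for disjoint \<open>S\<close>, \<open>T\<close> takes one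
  transposition for each pair \<open>t < s\<close>, whence the sign; if \<open>S\<close> and \<open>T\<close> meet, the product vanishes.
\<close>

type_synonym 'f grassmann = "nat fset \<Rightarrow>\<^sub>0 'f"

definition inversions :: "nat fset \<Rightarrow> nat fset \<Rightarrow> (nat \<times> nat) set" where
  "inversions S T = {(s, t). s |\<in>| S \<and> t |\<in>| T \<and> t < s}"

definition grassmann_sign :: "nat fset \<Rightarrow> nat fset \<Rightarrow> 'f::field" where
  "grassmann_sign S T = (if S |\<inter>| T = {||} then (- 1) ^ card (inversions S T) else 0)"

definition grassmann_mult :: "'f::field grassmann \<Rightarrow> 'f grassmann \<Rightarrow> 'f grassmann" where
  "grassmann_mult g h =
    (\<Sum>S\<in>Poly_Mapping.keys g. \<Sum>T\<in>Poly_Mapping.keys h.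
      Poly_Mapping.single (S |\<union>| T)
        (grassmann_sign S T * (Poly_Mapping.lookup g S * Poly_Mapping.lookup h T)))"

definition grassmann_even :: "'f::field grassmann set" where
  "grassmann_even = {g. \<forall>S\<in>Poly_Mapping.keys g. even (fcard S)}"

definition grassmann_odd :: "'f::field grassmann set" where
  "grassmann_odd = {g. \<forall>S\<in>Poly_Mapping.keys g. odd (fcard S)}"


section \<open>Tensor products with the Grassmann algebra\<close>

text \<open>
  As \<open>(e\<^sub>S)\<close> is a basis of \<open>G\<close>, every element of \<open>G \<otimes> V\<close> is uniquely a finite sum of terms
  \<open>e\<^sub>S \<otimes> v\<^sub>S\<close>.  So \<open>G \<otimes> V\<close> is modelled by the finitely supported families \<open>(v\<^sub>S)\<close>;
  \<open>grassmann_tensor_universal\<close> below is its universal property.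
\<close>

definition tensor_scale :: "('f::field \<Rightarrow> 'v::ab_group_add \<Rightarrow> 'v) \<Rightarrow>
    'f \<Rightarrow> (nat fset \<Rightarrow>\<^sub>0 'v) \<Rightarrow> (nat fset \<Rightarrow>\<^sub>0 'v)" where
  "tensor_scale scale c = Poly_Mapping.map (scale c)"

definition tensor :: "('f::field \<Rightarrow> 'v::ab_group_add \<Rightarrow> 'v) \<Rightarrow>
    'f grassmann \<Rightarrow> 'v \<Rightarrow> (nat fset \<Rightarrow>\<^sub>0 'v)" where
  "tensor scale g v = Poly_Mapping.map (\<lambda>c. scale c v) g"

text \<open>The product \<open>(g \<otimes> v)(h \<otimes> w) = gh \<otimes> vw\<close>, written on the terms \<open>e\<^sub>S \<otimes> v\<^sub>S\<close>; see
  \<open>tensor_mult_tensor\<close>.\<close>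

definition tensor_mult :: "('f::field \<Rightarrow> 'v::ab_group_add \<Rightarrow> 'v) \<Rightarrow> ('v \<Rightarrow> 'v \<Rightarrow> 'v) \<Rightarrow>
    (nat fset \<Rightarrow>\<^sub>0 'v) \<Rightarrow> (nat fset \<Rightarrow>\<^sub>0 'v) \<Rightarrow> (nat fset \<Rightarrow>\<^sub>0 'v)" where
  "tensor_mult scale mult u w =
    (\<Sum>S\<in>Poly_Mapping.keys u. \<Sum>T\<in>Poly_Mapping.keys w.
      tensor scale (grassmann_mult (Poly_Mapping.single S 1) (Poly_Mapping.single T 1))
        (mult (Poly_Mapping.lookup u S) (Poly_Mapping.lookup w T)))"

definition tensor_subspace :: "('f::field \<Rightarrow> 'v::ab_group_add \<Rightarrow> 'v) \<Rightarrow>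
    'f grassmann set \<Rightarrow> 'v set \<Rightarrow> (nat fset \<Rightarrow>\<^sub>0 'v) set" where
  "tensor_subspace scale H W =
    module.span (tensor_scale scale) {tensor scale g v | g v. g \<in> H \<and> v \<in> W}"

definition grassmann_envelope :: "('f::field \<Rightarrow> 'v::ab_group_add \<Rightarrow> 'v) \<Rightarrow>
    'v set \<Rightarrow> 'v set \<Rightarrow> (nat fset \<Rightarrow>\<^sub>0 'v) set" where
  "grassmann_envelope scale J0 J1 =
    {p + q | p q. p \<in> tensor_subspace scale grassmann_even J0 \<and>
                  q \<in> tensor_subspace scale grassmann_odd J1}"

locale jordan_superalgebra = superalgebra scale mult J0 J1
  for scale :: "'f::field \<Rightarrow> 'v::ab_group_add \<Rightarrow> 'v" and mult :: "'v \<Rightarrow> 'v \<Rightarrow> 'v"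
    and J0 :: "'v set" and J1 :: "'v set" +
  assumes envelope_jordan:
    "jordan_algebra_on (tensor_scale scale) (grassmann_envelope scale J0 J1)
      (tensor_mult scale mult)"


section \<open>The Kantor double\<close>

text \<open>The pair \<open>(a, b)\<close> stands for \<open>a + bx\<close>.\<close>

definition kantor_scale :: "('f \<Rightarrow> 'v \<Rightarrow> 'v) \<Rightarrow> 'f \<Rightarrow> 'v \<times> 'v \<Rightarrow> 'v \<times> 'v" where
  "kantor_scale scale c = (\<lambda>(a, b). (scale c a, scale c b))"

definition kantor_mult :: "('v::ab_group_add \<Rightarrow> 'v \<Rightarrow> 'v) \<Rightarrow> ('v \<Rightarrow> 'v \<Rightarrow> 'v) \<Rightarrow>
    'v \<times> 'v \<Rightarrow> 'v \<times> 'v \<Rightarrow> 'v \<times> 'v" where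
  "kantor_mult dot bracket = (\<lambda>(a, b) (c, d). (dot a c + bracket b d, dot a d + dot b c))"

definition kantor_even :: "('v::ab_group_add \<times> 'v) set" where
  "kantor_even = UNIV \<times> {0}"

definition kantor_odd :: "('v::ab_group_add \<times> 'v) set" where
  "kantor_odd = {0} \<times> UNIV"


section \<open>Basic facts about the constructions\<close>

lemma finite_inversions: "finite (inversions S T)"
  by (rule finite_subset[of _ "fset S \<times> fset T"]) (auto simp: inversions_def)

lemma grassmann_mult_single:
  "grassmann_mult (Poly_Mapping.single S a) (Poly_Mapping.single T b) =
    Poly_Mapping.single (S |\<union>| T) (grassmann_sign S T * (a * b))"
  by (simp add: grassmann_mult_def)

lemma grassmann_generators_anticommute:
  "grassmann_mult (Poly_Mapping.single {|i|} 1) (Poly_Mapping.single {|j|} (1::'f::field)) =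
    - grassmann_mult (Poly_Mapping.single {|j|} 1) (Poly_Mapping.single {|i|} 1)"
proof -
  have card_inv: "card (inversions {|i|} {|j|}) = (if j < i then 1 else 0)" for i j :: nat
  proof -
    have "inversions {|i|} {|j|} = (if j < i then {(i, j)} else {})"
      by (auto simp: inversions_def)
    then show ?thesis by simp
  qed
  show ?thesis
    by (cases i j rule: linorder_cases)
      (auto simp: grassmann_mult_single grassmann_sign_def card_inv single_uminus[symmetric]
        finsert_commute)
qed

lemma grassmann_generator_square:
  "grassmann_mult (Poly_Mapping.single {|i|} 1) (Poly_Mapping.single {|i|} (1::'f::field)) = 0"
  by (simp add: grassmann_mult_single grassmann_sign_def)

lemma grassmann_monomial:
  assumes "\<And>s. s |\<in>| S \<Longrightarrow> i < s"
  shows "grassmann_mult (Poly_Mapping.single {|i|} 1) (Poly_Mapping.single S 1) =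
    Poly_Mapping.single (finsert i S) (1::'f::field)"
proof -
  have "inversions {|i|} S = {}" and "i |\<notin>| S"
    using assms by (fastforce simp: inversions_def)+
  then show ?thesis
    by (simp add: grassmann_mult_single grassmann_sign_def)
qed

lemma sum_over_keys:
  fixes u :: "'k \<Rightarrow>\<^sub>0 'v::zero"
  assumes "finite F" "Poly_Mapping.keys u \<subseteq> F" "\<And>S. f S 0 = (0::'w::comm_monoid_add)"
  shows "(\<Sum>S\<in>Poly_Mapping.keys u. f S (Poly_Mapping.lookup u S)) =
    (\<Sum>S\<in>F. f S (Poly_Mapping.lookup u S))"
  using assms by (intro sum.mono_neutral_left) (auto simp: in_keys_iff)

lemma sum_over_keys_add:
  fixes u w :: "'k \<Rightarrow>\<^sub>0 'v::monoid_add"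
  assumes "\<And>S. f S 0 = (0::'w::comm_monoid_add)"
    and "\<And>S x y. f S (x + y) = f S x + f S y"
  shows "(\<Sum>S\<in>Poly_Mapping.keys (u + w). f S (Poly_Mapping.lookup (u + w) S)) =
    (\<Sum>S\<in>Poly_Mapping.keys u. f S (Poly_Mapping.lookup u S)) +
    (\<Sum>S\<in>Poly_Mapping.keys w. f S (Poly_Mapping.lookup w S))"
proof -
  define F where "F = Poly_Mapping.keys u \<union> Poly_Mapping.keys w"
  have F: "finite F" "Poly_Mapping.keys u \<subseteq> F" "Poly_Mapping.keys w \<subseteq> F"
    "Poly_Mapping.keys (u + w) \<subseteq> F"
    using Poly_Mapping.keys_add[of u w] by (auto simp: F_def)
  show ?thesis
    unfolding sum_over_keys[where F = F and f = f, OF F(1,2) assms(1)]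
      sum_over_keys[where F = F and f = f, OF F(1,3) assms(1)]
      sum_over_keys[where F = F and f = f, OF F(1,4) assms(1)]
    by (simp add: assms lookup_add sum.distrib)
qed

lemma grassmann_sign_cocycle:
  "grassmann_sign S T * grassmann_sign (S |\<union>| T) U =
    (grassmann_sign T U * grassmann_sign S (T |\<union>| U) :: 'f::field)"
proof (cases "S |\<inter>| T = {||} \<and> S |\<inter>| U = {||} \<and> T |\<inter>| U = {||}")
  case True
  have "inversions (S |\<union>| T) U = inversions S U \<union> inversions T U"
    and "inversions S (T |\<union>| U) = inversions S T \<union> inversions S U"
    by (auto simp: inversions_def)
  moreover have "inversions S U \<inter> inversions T U = {}" "inversions S T \<inter> inversions S U = {}"
    using True by (auto simp: inversions_def)
  ultimately have "card (inversions (S |\<union>| T) U) = card (inversions S U) + card (inversions T U)"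
    and "card (inversions S (T |\<union>| U)) = card (inversions S T) + card (inversions S U)"
    by (simp_all add: card_Un_disjoint finite_inversions)
  then show ?thesis
    using True by (simp add: grassmann_sign_def inf_sup_distrib1 inf_sup_distrib2 power_add)
next
  case False
  then show ?thesis
    by (auto simp: grassmann_sign_def inf_sup_distrib1 inf_sup_distrib2)
qed

lemma grassmann_monomials_assoc:
  fixes S T U :: "nat fset"
  defines "e \<equiv> \<lambda>S. Poly_Mapping.single S (1::'f::field)"
  shows "grassmann_mult (grassmann_mult (e S) (e T)) (e U) =
    grassmann_mult (e S) (grassmann_mult (e T) (e U))"
  using grassmann_sign_cocycle[of S T U, where 'f = 'f]
  by (simp add: e_def grassmann_mult_single sup_assoc mult.commute)

context vector_space
begin

lemma lookup_tensor_scale: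
  "Poly_Mapping.lookup (tensor_scale scale c u) S = scale c (Poly_Mapping.lookup u S)"
  by (simp add: tensor_scale_def Poly_Mapping.map.rep_eq when_def)

lemma lookup_tensor:
  "Poly_Mapping.lookup (tensor scale g v) S = scale (Poly_Mapping.lookup g S) v"
  by (simp add: tensor_def Poly_Mapping.map.rep_eq when_def)

lemma vector_space_tensor: "vector_space (tensor_scale scale)"
  by unfold_locales
    (auto intro!: poly_mapping_eqI simp: lookup_tensor_scale lookup_add algebra_simps)

lemma tensor_add_left: "tensor scale (g + h) v = tensor scale g v + tensor scale h v"
  by (auto intro!: poly_mapping_eqI simp: lookup_tensor lookup_add algebra_simps)

lemma tensor_add_right: "tensor scale g (v + w) = tensor scale g v + tensor scale g w"
  by (auto intro!: poly_mapping_eqI simp: lookup_tensor lookup_add algebra_simps)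

lemma tensor_scale_left:
  "tensor scale (tensor_scale (*) c g) v = tensor_scale scale c (tensor scale g v)"
  by (auto intro!: poly_mapping_eqI
      simp: lookup_tensor lookup_tensor_scale tensor_scale_def Poly_Mapping.map.rep_eq when_def)

lemma tensor_scale_right: "tensor scale g (scale c v) = tensor_scale scale c (tensor scale g v)"
  by (auto intro!: poly_mapping_eqI simp: lookup_tensor lookup_tensor_scale mult.commute)

lemma tensor_single:
  "tensor scale (Poly_Mapping.single S c) v = Poly_Mapping.single S (scale c v)"
  by (auto intro!: poly_mapping_eqI simp: lookup_tensor lookup_single when_def)

lemma tensor_expansion:
  "u = (\<Sum>S\<in>Poly_Mapping.keys u. tensor scale (Poly_Mapping.single S 1) (Poly_Mapping.lookup u S))"
  by (auto intro!: poly_mapping_eqI simp: tensor_single lookup_sum lookup_single when_def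
      sum.delta in_keys_iff)

lemma tensor_sum_left: "tensor scale (\<Sum>i\<in>I. g i) v = (\<Sum>i\<in>I. tensor scale (g i) v)"
  by (auto intro!: poly_mapping_eqI simp: lookup_tensor lookup_sum scale_sum_left)

lemma grassmann_tensor_universal:
  fixes scale' :: "'a \<Rightarrow> 'w::ab_group_add \<Rightarrow> 'w" and B :: "'a grassmann \<Rightarrow> 'b \<Rightarrow> 'w"
  assumes left: "\<And>v. Vector_Spaces.linear (tensor_scale (*)) scale' (\<lambda>g. B g v)"
    and right: "\<And>g. Vector_Spaces.linear scale scale' (B g)"
  shows "\<exists>!\<phi>. Vector_Spaces.linear (tensor_scale scale) scale' \<phi> \<and>
    (\<forall>g v. \<phi> (tensor scale g v) = B g v)"
proof -
  interpret R: Vector_Spaces.linear scale scale' "B g" for g by (rule right)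
  interpret L: Vector_Spaces.linear "tensor_scale (*)" scale' "\<lambda>g. B g v" for v by (rule left)
  define \<phi> where "\<phi> u = (\<Sum>S\<in>Poly_Mapping.keys u.
    B (Poly_Mapping.single S 1) (Poly_Mapping.lookup u S))" for u
  have "\<phi> (u + w) = \<phi> u + \<phi> w" for u w
    unfolding \<phi>_def by (rule sum_over_keys_add) (simp_all add: R.zero R.add)
  moreover have "\<phi> (tensor_scale scale c u) = scale' c (\<phi> u)" for c u
  proof -
    have "Poly_Mapping.keys (tensor_scale scale c u) \<subseteq> Poly_Mapping.keys u"
      by (auto simp: in_keys_iff lookup_tensor_scale)
    then have "\<phi> (tensor_scale scale c u) = (\<Sum>S\<in>Poly_Mapping.keys u.
        B (Poly_Mapping.single S 1) (Poly_Mapping.lookup (tensor_scale scale c u) S))"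
      unfolding \<phi>_def by (intro sum_over_keys) (simp_all add: R.zero)
    then show ?thesis
      by (simp add: \<phi>_def lookup_tensor_scale R.scale R.vs2.scale_sum_right)
  qed
  ultimately have lin: "Vector_Spaces.linear (tensor_scale scale) scale' \<phi>"
    using R.vs2.vector_space_axioms vector_space_tensor
    by (simp add: Vector_Spaces.linear_iff)
  have tensor: "\<phi> (tensor scale g v) = B g v" for g v
  proof -
    have "Poly_Mapping.keys (tensor scale g v) \<subseteq> Poly_Mapping.keys g"
      by (auto simp: in_keys_iff lookup_tensor)
    then have "\<phi> (tensor scale g v) = (\<Sum>S\<in>Poly_Mapping.keys g.
        B (Poly_Mapping.single S 1) (Poly_Mapping.lookup (tensor scale g v) S))"
      unfolding \<phi>_def by (intro sum_over_keys) (simp_all add: R.zero)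
    also have "\<dots> = (\<Sum>S\<in>Poly_Mapping.keys g.
        B (tensor_scale (*) (Poly_Mapping.lookup g S) (Poly_Mapping.single S 1)) v)"
      by (simp add: lookup_tensor R.scale L.scale)
    also have "\<dots> = B (\<Sum>S\<in>Poly_Mapping.keys g.
        tensor_scale (*) (Poly_Mapping.lookup g S) (Poly_Mapping.single S 1)) v"
      by (simp add: L.sum)
    also have "(\<Sum>S\<in>Poly_Mapping.keys g.
        tensor_scale (*) (Poly_Mapping.lookup g S) (Poly_Mapping.single S 1)) = g"
      by (auto intro!: poly_mapping_eqI simp: lookup_sum tensor_scale_def
          Poly_Mapping.map.rep_eq lookup_single when_def in_keys_iff)
    finally show ?thesis .
  qed
  have unique: "\<psi> = \<phi>" if lin': "Vector_Spaces.linear (tensor_scale scale) scale' \<psi>"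
    and \<psi>: "\<forall>g v. \<psi> (tensor scale g v) = B g v" for \<psi>
  proof
    fix u
    interpret P: Vector_Spaces.linear "tensor_scale scale" scale' \<psi> by (rule lin')
    have "\<psi> u = \<psi> (\<Sum>S\<in>Poly_Mapping.keys u.
        tensor scale (Poly_Mapping.single S 1) (Poly_Mapping.lookup u S))"
      using tensor_expansion[of u] by simp
    then show "\<psi> u = \<phi> u"
      by (simp only: P.sum \<psi> \<phi>_def)
  qed
  show ?thesis
    using lin tensor unique by blast
qed

lemma tensor_subspace_lookup:
  assumes "subspace W"
  shows "u \<in> tensor_subspace scale {g. \<forall>S\<in>Poly_Mapping.keys g. P S} W \<longleftrightarrow>
    (\<forall>S. (P S \<longrightarrow> Poly_Mapping.lookup u S \<in> W) \<and> (\<not> P S \<longrightarrow> Poly_Mapping.lookup u S = 0))"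
    (is "u \<in> tensor_subspace scale ?H W \<longleftrightarrow> ?Q u")
proof -
  interpret T: vector_space "tensor_scale scale" by (rule vector_space_tensor)
  show ?thesis
  proof
    have "T.subspace (Collect ?Q)"
      using assms unfolding T.subspace_def subspace_def
      by (auto simp: lookup_add lookup_tensor_scale)
    moreover have "{tensor scale g v | g v. g \<in> ?H \<and> v \<in> W} \<subseteq> Collect ?Q"
      using assms by (auto simp: lookup_tensor in_keys_iff subspace_def)
    ultimately show "?Q u" if "u \<in> tensor_subspace scale ?H W"
      using that T.span_minimal[of _ "Collect ?Q"] unfolding tensor_subspace_def by blast
  next
    assume Q: "?Q u"
    have "tensor scale (Poly_Mapping.single S 1) (Poly_Mapping.lookup u S)
        \<in> T.span {tensor scale g v | g v. g \<in> ?H \<and> v \<in> W}"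
      if "S \<in> Poly_Mapping.keys u" for S
    proof (rule T.span_base)
      have "P S" and "Poly_Mapping.lookup u S \<in> W"
        using Q that by (auto simp: in_keys_iff)
      moreover from \<open>P S\<close> have "Poly_Mapping.single S 1 \<in> ?H" by auto
      ultimately show "tensor scale (Poly_Mapping.single S 1) (Poly_Mapping.lookup u S)
          \<in> {tensor scale g v | g v. g \<in> ?H \<and> v \<in> W}" by blast
    qed
    then have "(\<Sum>S\<in>Poly_Mapping.keys u.
        tensor scale (Poly_Mapping.single S 1) (Poly_Mapping.lookup u S))
        \<in> T.span {tensor scale g v | g v. g \<in> ?H \<and> v \<in> W}"
      by (rule T.span_sum)
    then show "u \<in> tensor_subspace scale ?H W"
      using tensor_expansion[of u] by (simp add: tensor_subspace_def)
  qed
qed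

end

lemma (in algebra_on) tensor_mult_tensor:
  assumes "A = UNIV"
  shows "tensor_mult scale mult (tensor scale g v) (tensor scale h w) =
    tensor scale (grassmann_mult g h) (mult v w)"
proof -
  have zero: "mult 0 y = 0" "mult x 0 = 0" for x y
    using mult_add_left[of 0 0 y] mult_add_right[of x 0 0] assms by simp_all
  define f where "f S T x y = tensor scale
    (grassmann_mult (Poly_Mapping.single S 1) (Poly_Mapping.single T 1)) (mult x y)" for S T x y
  have f0: "f S T 0 y = 0" "f S T x 0 = 0" for S T x y
    by (auto intro!: poly_mapping_eqI simp: f_def zero lookup_tensor)
  have keys: "Poly_Mapping.keys (tensor scale k z) \<subseteq> Poly_Mapping.keys k" for k z
    by (auto simp: in_keys_iff lookup_tensor)
  have "tensor_mult scale mult (tensor scale g v) (tensor scale h w) =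
      (\<Sum>S\<in>Poly_Mapping.keys (tensor scale g v). \<Sum>T\<in>Poly_Mapping.keys (tensor scale h w).
        f S T (Poly_Mapping.lookup (tensor scale g v) S) (Poly_Mapping.lookup (tensor scale h w) T))"
    by (simp add: tensor_mult_def f_def)
  also have "\<dots> = (\<Sum>S\<in>Poly_Mapping.keys (tensor scale g v). \<Sum>T\<in>Poly_Mapping.keys h.
        f S T (Poly_Mapping.lookup (tensor scale g v) S) (Poly_Mapping.lookup (tensor scale h w) T))"
    by (intro sum.cong refl sum_over_keys) (auto simp: f0 keys)
  also have "\<dots> = (\<Sum>S\<in>Poly_Mapping.keys g. \<Sum>T\<in>Poly_Mapping.keys h.
        f S T (Poly_Mapping.lookup (tensor scale g v) S) (Poly_Mapping.lookup (tensor scale h w) T))"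
    by (rule sum_over_keys) (auto simp: f0 keys)
  also have "\<dots> = (\<Sum>S\<in>Poly_Mapping.keys g. \<Sum>T\<in>Poly_Mapping.keys h.
      tensor scale (Poly_Mapping.single (S |\<union>| T)
        (grassmann_sign S T * (Poly_Mapping.lookup g S * Poly_Mapping.lookup h T))) (mult v w))"
    using assms
    by (simp add: f_def lookup_tensor mult_scale_left mult_scale_right grassmann_mult_single
        tensor_single mult.commute)
  also have "\<dots> = tensor scale (grassmann_mult g h) (mult v w)"
    by (simp add: grassmann_mult_def tensor_sum_left)
  finally show ?thesis .
qed

end

theory Submission
  imports Defs
begin

text \<open>
  Write an element of the Grassmann envelope as \<open>a + bx\<close> with \<open>a\<close> even and \<open>b\<close> odd in
  \<open>G \<otimes> L\<close>.  On odd elements the extended bracket is symmetric, and with \<open>v = c + dx\<close> the Jordan identity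
  splits by degree into
  \<open>2a{ab,d} + {a\<^sup>2d,b} = a\<^sup>2{d,b} + 2{ab,ad}\<close>, \<open>{acb,b} = {ab,cb}\<close>, \<open>{{b,b}d,b} = {b,b}{d,b}\<close>
  and \<open>{ab,d}b = ab{d,b}\<close>.  The even multiples obey the transposed Leibniz rule, which gives the first
  two.  For the other two one lifts to odd elements the identities
  \<open>x[y,z] + y[z,x] + z[x,y] = 0\<close> and \<open>[h,x][y,z] + [h,y][z,x] + [h,z][x,y] = 0\<close>, valid in every
  transposed Poisson algebra of characteristic zero; setting variables equal yields
  \<open>b{b,b} = 0\<close> and \<open>{d,b}{b,b} = 0\<close>, so that both sides of the third identity vanish.
\<close>

section \<open>Products on the Grassmann tensor space\<close>

text \<open>Parity is a Boolean, \<open>True\<close> for even, so that a product of parities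
  \<open>e\<close> and \<open>e'\<close> has parity \<open>e = e'\<close>. The zero family has both
  parities, which takes care of vanishing products of monomials.\<close>

definition homogeneous :: "bool \<Rightarrow> (nat fset \<Rightarrow>\<^sub>0 'v::zero) \<Rightarrow> bool" where
  "homogeneous e u \<longleftrightarrow> (\<forall>S\<in>Poly_Mapping.keys u. even (fcard S) = e)"

text \<open>Every family is the finite sum of its basis tensors. The case \<open>single\<close>
  ranges only over \<open>S\<close> in the support of the given \<open>u\<close>, so that a parity
  assumption on \<open>u\<close> can be used there; the coefficient \<open>v\<close> is
  arbitrary.\<close>

lemma tensor_induct [case_names zero single add]:
  fixes u :: "nat fset \<Rightarrow>\<^sub>0 'v::ab_group_add"
  assumes "P 0" and "\<And>S v. S \<in> Poly_Mapping.keys u \<Longrightarrow> P (Poly_Mapping.single S v)"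
    and "\<And>u w. \<lbrakk>P u; P w\<rbrakk> \<Longrightarrow> P (u + w)"
  shows "P u"
proof -
  have u: "u = (\<Sum>S\<in>Poly_Mapping.keys u. Poly_Mapping.single S (Poly_Mapping.lookup u S))"
    by (auto intro!: poly_mapping_eqI simp: lookup_sum lookup_single when_def in_keys_iff)
  have "P (\<Sum>S\<in>F. Poly_Mapping.single S (Poly_Mapping.lookup u S))"
    if "finite F" "F \<subseteq> Poly_Mapping.keys u" for F
    using that by induction (auto intro: assms)
  then show ?thesis
    by (subst u) simp
qed

text \<open>Serves to prove multilinear identities: \<open>F\<close> is the difference of the two
  sides, or a sum claimed to vanish, and only basis tensors remain to be checked. The versions in
  two, three and four arguments make one argument after the other a basis tensor.\<close>

lemma additive_zero:
  fixes u :: "nat fset \<Rightarrow>\<^sub>0 'v::ab_group_add" and F :: "_ \<Rightarrow> 'w::ab_group_add"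
  assumes "\<And>u w. F (u + w) = F u + F w"
    and "\<And>S v. S \<in> Poly_Mapping.keys u \<Longrightarrow> F (Poly_Mapping.single S v) = 0"
  shows "F u = 0"
proof (rule tensor_induct[of "\<lambda>u. F u = 0"])
  show "F 0 = 0"
    using assms(1)[of 0 0] by simp
qed (simp_all add: assms)

lemma biadditive_zero:
  fixes u v :: "nat fset \<Rightarrow>\<^sub>0 'v::ab_group_add" and F :: "_ \<Rightarrow> _ \<Rightarrow> 'w::ab_group_add"
  assumes "\<And>u u' v. F (u + u') v = F u v + F u' v" "\<And>u v v'. F u (v + v') = F u v + F u v'"
    and "\<And>S T a b. \<lbrakk>S \<in> Poly_Mapping.keys u; T \<in> Poly_Mapping.keys v\<rbrakk> \<Longrightarrow>
      F (Poly_Mapping.single S a) (Poly_Mapping.single T b) = 0"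
  shows "F u v = 0"
proof (rule additive_zero[of "\<lambda>u. F u v"])
  fix S a
  assume S: "S \<in> Poly_Mapping.keys u"
  show "F (Poly_Mapping.single S a) v = 0"
    by (rule additive_zero[of "F (Poly_Mapping.single S a)"]; rule assms; (assumption | rule S)?)
qed (rule assms)

lemma triadditive_zero:
  fixes u v w :: "nat fset \<Rightarrow>\<^sub>0 'v::ab_group_add"
    and F :: "_ \<Rightarrow> _ \<Rightarrow> _ \<Rightarrow> 'w::ab_group_add"
  assumes "\<And>u u' v w. F (u + u') v w = F u v w + F u' v w"
    "\<And>u v v' w. F u (v + v') w = F u v w + F u v' w"
    "\<And>u v w w'. F u v (w + w') = F u v w + F u v w'"
    and "\<And>S T U a b c. \<lbrakk>S \<in> Poly_Mapping.keys u; T \<in> Poly_Mapping.keys v;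
        U \<in> Poly_Mapping.keys w\<rbrakk> \<Longrightarrow>
      F (Poly_Mapping.single S a) (Poly_Mapping.single T b) (Poly_Mapping.single U c) = 0"
  shows "F u v w = 0"
proof (rule additive_zero[of "\<lambda>u. F u v w"])
  fix S a
  assume S: "S \<in> Poly_Mapping.keys u"
  show "F (Poly_Mapping.single S a) v w = 0"
    by (rule biadditive_zero[of "F (Poly_Mapping.single S a)"]; rule assms; (assumption | rule S)?)
qed (rule assms)

lemma tetraadditive_zero:
  fixes u v w x :: "nat fset \<Rightarrow>\<^sub>0 'v::ab_group_add"
    and F :: "_ \<Rightarrow> _ \<Rightarrow> _ \<Rightarrow> _ \<Rightarrow> 'w::ab_group_add"
  assumes "\<And>u u' v w x. F (u + u') v w x = F u v w x + F u' v w x"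
    "\<And>u v v' w x. F u (v + v') w x = F u v w x + F u v' w x"
    "\<And>u v w w' x. F u v (w + w') x = F u v w x + F u v w' x"
    "\<And>u v w x x'. F u v w (x + x') = F u v w x + F u v w x'"
    and "\<And>S T U R a b c d. \<lbrakk>S \<in> Poly_Mapping.keys u; T \<in> Poly_Mapping.keys v;
        U \<in> Poly_Mapping.keys w; R \<in> Poly_Mapping.keys x\<rbrakk> \<Longrightarrow>
      F (Poly_Mapping.single S a) (Poly_Mapping.single T b) (Poly_Mapping.single U c)
        (Poly_Mapping.single R d) = 0"
  shows "F u v w x = 0"
proof (rule additive_zero[of "\<lambda>u. F u v w x"])
  fix S a
  assume S: "S \<in> Poly_Mapping.keys u"
  show "F (Poly_Mapping.single S a) v w x = 0"
    by (rule triadditive_zero[of "F (Poly_Mapping.single S a)"]; rule assms; (assumption | rule S)?)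
qed (rule assms)

section \<open>Parity, basis tensors and bilinearity of the product\<close>

lemma homogeneous_zero [simp]: "homogeneous e 0"
  by (simp add: homogeneous_def)

lemma homogeneous_add:
  fixes u w :: "nat fset \<Rightarrow>\<^sub>0 'v::ab_group_add"
  shows "\<lbrakk>homogeneous e u; homogeneous e w\<rbrakk> \<Longrightarrow> homogeneous e (u + w)"
  using Poly_Mapping.keys_add[of u w] by (auto simp: homogeneous_def)

lemma homogeneous_single: "even (fcard S) = e \<Longrightarrow> homogeneous e (Poly_Mapping.single S v)"
  by (simp add: homogeneous_def)

lemma algebra_zero:
  assumes "algebra_on scale UNIV m"
  shows "m 0 y = 0" "m x 0 = 0"
proof -
  interpret algebra_on scale UNIV m by fact
  show "m 0 y = 0" "m x 0 = 0"
    using mult_add_left[of 0 0 y] mult_add_right[of x 0 0] by simp_all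
qed

lemma tensor_mult_single:
  assumes "algebra_on scale UNIV m"
  shows "tensor_mult scale m (Poly_Mapping.single S v) (Poly_Mapping.single T w) =
    Poly_Mapping.single (S |\<union>| T) (scale (grassmann_sign S T) (m v w))"
proof -
  interpret algebra_on scale UNIV m by fact
  show ?thesis
    \<comment> \<open>The basis tensor \<open>single S v\<close> is the pure tensor of
      \<open>single S 1\<close> and \<open>v\<close>, so the product formula for pure tensors
      applies.\<close>
    using tensor_mult_tensor[OF refl, of "Poly_Mapping.single S 1" v "Poly_Mapping.single T 1" w]
    by (simp add: tensor_single grassmann_mult_single)
qed

lemma tensor_mult_zero:
  "tensor_mult scale m 0 w = 0" "tensor_mult scale m u 0 = 0"
  by (simp_all add: tensor_mult_def)

lemma tensor_mult_add_left:
  assumes "algebra_on scale UNIV m"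
  shows "tensor_mult scale m (u + v) w = tensor_mult scale m u w + tensor_mult scale m v w"
proof -
  interpret algebra_on scale UNIV m by fact
  have z: "tensor scale g 0 = 0" for g
    by (auto intro!: poly_mapping_eqI simp: lookup_tensor)
  show ?thesis
    unfolding tensor_mult_def
    by (rule sum_over_keys_add[where f = "\<lambda>S x. \<Sum>T\<in>Poly_Mapping.keys w. tensor scale
          (grassmann_mult (Poly_Mapping.single S 1) (Poly_Mapping.single T 1))
          (m x (Poly_Mapping.lookup w T))"])
      (simp_all add: algebra_zero[OF assms] z mult_add_left tensor_add_right sum.distrib)
qed

lemma tensor_mult_add_right:
  assumes "algebra_on scale UNIV m"
  shows "tensor_mult scale m w (u + v) = tensor_mult scale m w u + tensor_mult scale m w v"
proof -
  interpret algebra_on scale UNIV m by fact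
  have z: "tensor scale g 0 = 0" for g
    by (auto intro!: poly_mapping_eqI simp: lookup_tensor)
  show ?thesis
    \<comment> \<open>Interchanging the sums brings the sum over the support of \<open>u + v\<close>
      to the outside, where \<open>sum_over_keys_add\<close> applies.\<close>
    unfolding tensor_mult_def sum.swap[where A = "Poly_Mapping.keys w"]
    by (rule sum_over_keys_add[where f = "\<lambda>T x. \<Sum>S\<in>Poly_Mapping.keys w. tensor scale
          (grassmann_mult (Poly_Mapping.single S 1) (Poly_Mapping.single T 1))
          (m (Poly_Mapping.lookup w S) x)"])
      (simp_all add: algebra_zero[OF assms] z mult_add_right tensor_add_right sum.distrib)
qed

lemma (in vector_space) tensor_scale_single:
  "tensor_scale scale c (Poly_Mapping.single S v) = Poly_Mapping.single S (scale c v)"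
  by (auto intro!: poly_mapping_eqI simp: lookup_tensor_scale lookup_single when_def)

lemma tensor_mult_scale:
  assumes "algebra_on scale UNIV m"
  shows "tensor_mult scale m (tensor_scale scale c u) w = tensor_scale scale c (tensor_mult scale m u w)"
    and "tensor_mult scale m u (tensor_scale scale c w) = tensor_scale scale c (tensor_mult scale m u w)"
proof -
  interpret algebra_on scale UNIV m by fact
  interpret T: vector_space "tensor_scale scale" by (rule vector_space_tensor)
  note simps = tensor_mult_zero tensor_mult_add_left[OF assms] tensor_mult_add_right[OF assms]
    T.scale_right_distrib tensor_scale_single tensor_mult_single[OF assms]
    mult_scale_left mult_scale_right mult.commute
  show "tensor_mult scale m (tensor_scale scale c u) w = tensor_scale scale c (tensor_mult scale m u w)"
  proof (induction u rule: tensor_induct)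
    case (single S v)
    show ?case
      by (induction w rule: tensor_induct) (simp_all add: simps)
  qed (simp_all add: simps)
  show "tensor_mult scale m u (tensor_scale scale c w) = tensor_scale scale c (tensor_mult scale m u w)"
  proof (induction u rule: tensor_induct)
    case (single S v)
    show ?case
      by (induction w rule: tensor_induct) (simp_all add: simps)
  qed (simp_all add: simps)
qed

section \<open>Parity of products and symmetries of the Grassmann sign\<close>

lemma grassmann_sign_meet:
  "S |\<inter>| T \<noteq> {||} \<Longrightarrow> grassmann_sign S T = 0"
  by (simp add: grassmann_sign_def)

lemma fcard_funion_disjoint:
  assumes "S |\<inter>| T = {||}"
  shows "fcard (S |\<union>| T) = fcard S + fcard T"
  using fcard_funion_fsubset by (metis add.right_neutral assms fcard_funion_finter fcard_fempty)

text \<open>For disjoint \<open>S\<close> and \<open>T\<close> the cardinalities add; if they meet,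
  the product of the basis tensors is zero, which has either parity.\<close>

lemma homogeneous_tensor_mult:
  assumes "algebra_on scale UNIV m" "homogeneous e u" "homogeneous e' w"
  shows "homogeneous (e = e') (tensor_mult scale m u w)"
proof -
  interpret algebra_on scale UNIV m by fact
  have "homogeneous (e = e') (tensor_mult scale m (Poly_Mapping.single S v) (Poly_Mapping.single T v'))"
    if "even (fcard S) = e" "even (fcard T) = e'" for S T v v'
    using that by (cases "S |\<inter>| T = {||}")
      (auto simp: tensor_mult_single[OF assms(1)] grassmann_sign_meet
        fcard_funion_disjoint intro!: homogeneous_single)
  note single = this
  have left: "homogeneous (e = e') (tensor_mult scale m (Poly_Mapping.single S v) w)"
    if "even (fcard S) = e" for S v
  proof (rule tensor_induct[of _ w])
    fix T x
    assume "T \<in> Poly_Mapping.keys w"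
    with assms(3) that
    show "homogeneous (e = e')
        (tensor_mult scale m (Poly_Mapping.single S v) (Poly_Mapping.single T x))"
      by (intro single) (auto simp: homogeneous_def)
  qed (simp_all add: tensor_mult_zero tensor_mult_add_right[OF assms(1)] homogeneous_add)
  show ?thesis
    by (rule tensor_induct[of _ u]) (use assms(2) in \<open>auto simp: homogeneous_def[of _ u]
        tensor_mult_zero tensor_mult_add_left[OF assms(1)] intro!: homogeneous_add left\<close>)
qed

text \<open>For disjoint \<open>S\<close> and \<open>T\<close>, the inversions of (S, T) and the
  swapped inversions of (T, S) partition the product of the two sets, so the two exponents add up to
  \<open>fcard S * fcard T\<close>. If the sets meet, both signs are 0.\<close>

lemma grassmann_sign_swap:
  "grassmann_sign T S = (- 1) ^ (fcard S * fcard T) * (grassmann_sign S T :: 'f::field)"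
proof (cases "S |\<inter>| T = {||}")
  case True
  have fin: "finite (prod.swap ` inversions T S)"
    by (simp add: finite_inversions)
  have "inversions S T \<inter> prod.swap ` inversions T S = {}"
    by (auto simp: inversions_def)
  moreover have "inversions S T \<union> prod.swap ` inversions T S = fset S \<times> fset T"
    using True by (auto simp: inversions_def image_iff)
  ultimately have "fcard S * fcard T = card (inversions S T) + card (inversions T S)"
    using card_Un_disjoint[OF finite_inversions[of S T] fin]
    by (simp add: card_cartesian_product fcard.rep_eq card_image)
  then have "(- 1 :: 'f) ^ (fcard S * fcard T) * (- 1) ^ card (inversions S T) =
      ((- 1) ^ card (inversions S T)) ^ 2 * (- 1) ^ card (inversions T S)"
    by (simp add: power_add power2_eq_square)
  then show ?thesis
    using True by (simp add: grassmann_sign_def inf_commute power_mult[symmetric])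
next
  case False
  then show ?thesis
    by (simp add: grassmann_sign_def inf_commute)
qed

lemma grassmann_sign_even:
  "even (fcard S) \<Longrightarrow> grassmann_sign T S = grassmann_sign S T"
  by (subst grassmann_sign_swap) simp

lemma grassmann_sign_odd:
  "\<lbrakk>odd (fcard S); odd (fcard T)\<rbrakk> \<Longrightarrow> grassmann_sign T S = - grassmann_sign S T"
  by (subst grassmann_sign_swap) simp

text \<open>The two sides are the coefficients of \<open>e_T (e_U e_S)\<close> and
  \<open>e_S (e_T e_U)\<close>. By the cocycle rule the first is that of
  \<open>(e_T e_U) e_S\<close>, and the even monomial \<open>e_T e_U\<close> moves past
  \<open>e_S\<close> without a sign. This is why cyclic identities lift to odd elements without
  signs.\<close>

lemma grassmann_sign_cyclic:
  assumes "odd (fcard S)" "odd (fcard T)" "odd (fcard U)"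
  shows "grassmann_sign U S * grassmann_sign T (U |\<union>| S) =
    (grassmann_sign T U * grassmann_sign S (T |\<union>| U) :: 'f::field)"
proof -
  have "grassmann_sign U S * grassmann_sign T (U |\<union>| S) =
      (grassmann_sign T U * grassmann_sign (T |\<union>| U) S :: 'f)"
    by (rule grassmann_sign_cocycle[symmetric])
  also have "\<dots> = grassmann_sign T U * grassmann_sign S (T |\<union>| U)"
    using assms by (cases "T |\<inter>| U = {||}")
      (auto simp: grassmann_sign_meet fcard_funion_disjoint
        grassmann_sign_even[of "T |\<union>| U" S])
  finally show ?thesis .
qed


section \<open>Transposed Poisson algebras in characteristic zero\<close>

locale transposed_poisson_algebra_char_0 = transposed_poisson_algebra scale dot bracket
  for scale :: "'f::field_char_0 \<Rightarrow> 'v::ab_group_add \<Rightarrow> 'v" and dot bracket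
begin

section \<open>Identities in the transposed Poisson algebra itself\<close>

lemma dot_algebra: "algebra_on scale UNIV dot"
  using comm_assoc_algebra_axioms comm_assoc_algebra.axioms(1) by blast

lemma bracket_algebra: "algebra_on scale UNIV bracket"
  using lie_algebra_axioms lie_algebra.axioms(1) by blast

lemmas dot_add = algebra_on.mult_add_left[OF dot_algebra UNIV_I UNIV_I UNIV_I]
  algebra_on.mult_add_right[OF dot_algebra UNIV_I UNIV_I UNIV_I]
lemmas bracket_add = algebra_on.mult_add_left[OF bracket_algebra UNIV_I UNIV_I UNIV_I]
  algebra_on.mult_add_right[OF bracket_algebra UNIV_I UNIV_I UNIV_I]
lemmas dot_scale = algebra_on.mult_scale_left[OF dot_algebra UNIV_I UNIV_I]
  algebra_on.mult_scale_right[OF dot_algebra UNIV_I UNIV_I]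
lemmas bracket_scale = algebra_on.mult_scale_left[OF bracket_algebra UNIV_I UNIV_I]
  algebra_on.mult_scale_right[OF bracket_algebra UNIV_I UNIV_I]
lemmas dot_zero = algebra_zero[OF dot_algebra]
lemmas bracket_zero = algebra_zero[OF bracket_algebra]

lemma bracket_anticommute: "bracket x y = - bracket y x"
proof -
  have "bracket x y + bracket y x = 0"
    using alternating[of "x + y"] unfolding bracket_add by (simp add: alternating add.commute)
  then show ?thesis by (simp add: eq_neg_iff_add_eq_0)
qed

lemma double_zero: "x + x = 0 \<Longrightarrow> x = (0::'v)"
proof -
  assume "x + x = 0"
  then have "scale 2 x = 0"
    using scale_left_distrib[of 1 1 x] by simp
  then show ?thesis by simp
qed

lemma triple_zero: "x + x + x = 0 \<Longrightarrow> x = (0::'v)"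
proof -
  assume "x + x + x = 0"
  then have "scale 3 x = 0"
    using scale_left_distrib[of 1 1 x] scale_left_distrib[of 2 1 x] by simp
  then show ?thesis by simp
qed

text \<open>With the factor 2 spelled out as a sum, the rule is purely additive and can be rewritten
  inside sums and lifted to tensors.\<close>

lemma leibniz: "dot z (bracket x y) + dot z (bracket x y) = bracket (dot z x) y + bracket x (dot z y)"
  using transposed_leibniz[of z x y] scale_left_distrib[of 1 1 "dot z (bracket x y)"] by simp

text \<open>Doubling each term and applying the Leibniz rule gives six brackets, which cancel in
  pairs such as \<open>bracket (dot x y) z\<close> and \<open>bracket z (dot y x)\<close>.\<close>

lemma dot_bracket_cyclic: "dot x (bracket y z) + dot y (bracket z x) + dot z (bracket x y) = 0"
  (is "?p + ?q + ?r = 0")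
proof (rule double_zero)
  have "(?p + ?q + ?r) + (?p + ?q + ?r) = (?p + ?p) + (?q + ?q) + (?r + ?r)"
    by (simp add: algebra_simps)
  also have "\<dots> = 0"
    unfolding leibniz bracket_anticommute[of y "dot z x"] bracket_anticommute[of z "dot x y"]
      bracket_anticommute[of x "dot y z"] commute[of y x] commute[of z y] commute[of x z]
    by (simp add: algebra_simps)
  finally show "(?p + ?q + ?r) + (?p + ?q + ?r) = 0" .
qed

text \<open>Let \<open>Q\<close> be the sum in question and \<open>P\<close> the sum with
  \<open>h\<close> moved to the outer argument. The Leibniz rule turns twice \<open>h\<close> times
  the Jacobi identity into P + Q = 0. Expanding the inner products in 2Q gives P + 2Q as the sum of
  the Jacobi identities for (hx, y, z), (x, hy, z) and (x, y, hz), hence P + 2Q = 0. Subtracting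
  leaves Q = 0.\<close>

lemma bracket_dot_bracket_cyclic:
  "bracket x (dot h (bracket y z)) + bracket y (dot h (bracket z x)) +
    bracket z (dot h (bracket x y)) = 0"
proof -
  define P where "P = bracket (dot h x) (bracket y z) + bracket (dot h y) (bracket z x) +
    bracket (dot h z) (bracket x y)"
  define Q where "Q = bracket x (dot h (bracket y z)) + bracket y (dot h (bracket z x)) +
    bracket z (dot h (bracket x y))"
  have "dot h (bracket x (bracket y z) + bracket y (bracket z x) + bracket z (bracket x y)) = 0"
    by (simp add: jacobi dot_zero)
  then have j: "dot h (bracket x (bracket y z)) + dot h (bracket y (bracket z x)) +
      dot h (bracket z (bracket x y)) = 0"
    by (simp add: dot_add)
  have "P + Q = (dot h (bracket x (bracket y z)) + dot h (bracket y (bracket z x)) +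
      dot h (bracket z (bracket x y))) + (dot h (bracket x (bracket y z)) + dot h (bracket y (bracket z x)) +
      dot h (bracket z (bracket x y)))"
    using leibniz[of h x "bracket y z"] leibniz[of h y "bracket z x"] leibniz[of h z "bracket x y"]
    unfolding P_def Q_def by (simp add: algebra_simps)
  then have 1: "P + Q = 0"
    by (simp only: j) simp
  have "Q + Q = bracket x (dot h (bracket y z) + dot h (bracket y z)) +
     bracket y (dot h (bracket z x) + dot h (bracket z x)) +
     bracket z (dot h (bracket x y) + dot h (bracket x y))"
    unfolding Q_def by (simp add: algebra_simps bracket_add)
  also have "\<dots> = bracket x (bracket (dot h y) z) + bracket x (bracket y (dot h z))
     + bracket y (bracket (dot h z) x) + bracket y (bracket z (dot h x))
     + bracket z (bracket (dot h x) y) + bracket z (bracket x (dot h y))"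
    unfolding leibniz by (simp add: bracket_add algebra_simps)
  finally have "P + (Q + Q) =
     (bracket (dot h x) (bracket y z) + bracket y (bracket z (dot h x)) + bracket z (bracket (dot h x) y)) +
     (bracket (dot h y) (bracket z x) + bracket z (bracket x (dot h y)) + bracket x (bracket (dot h y) z)) +
     (bracket (dot h z) (bracket x y) + bracket x (bracket y (dot h z)) + bracket y (bracket (dot h z) x))"
    unfolding P_def by (simp add: algebra_simps)
  then have "P + (Q + Q) = 0"
    by (simp add: jacobi)
  then have "(P + Q) + Q = 0"
    by (simp only: add.assoc)
  with 1 show ?thesis
    by (simp add: Q_def)
qed

text \<open>The bracket [y,z] itself is taken as the multiplier in the Leibniz rule: 2[h,x][y,z] =
  [h, x[y,z]] - [x, h[y,z]]. Summed cyclically, the first terms vanish by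
  \<open>dot_bracket_cyclic\<close> and the second by
  \<open>bracket_dot_bracket_cyclic\<close>.\<close>

lemma bracket_bracket_cyclic:
  "dot (bracket h x) (bracket y z) + dot (bracket h y) (bracket z x) +
    dot (bracket h z) (bracket x y) = 0" (is "?p + ?q + ?r = 0")
proof (rule double_zero)
  have two: "dot (bracket h x) (bracket y z) + dot (bracket h x) (bracket y z) =
      bracket h (dot x (bracket y z)) - bracket x (dot h (bracket y z))" for x y z
    using leibniz[of "bracket y z" h x] bracket_anticommute[of "dot h (bracket y z)" x]
    by (simp add: commute[of _ "bracket y z"] algebra_simps)
  have "(?p + ?q + ?r) + (?p + ?q + ?r) = (?p + ?p) + (?q + ?q) + (?r + ?r)"
    by (simp add: algebra_simps)
  also have "\<dots> = bracket h (dot x (bracket y z) + dot y (bracket z x) + dot z (bracket x y)) -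
      (bracket x (dot h (bracket y z)) + bracket y (dot h (bracket z x)) +
      bracket z (dot h (bracket x y)))"
    unfolding two by (simp add: bracket_add algebra_simps)
  also have "\<dots> = 0"
    by (simp add: dot_bracket_cyclic bracket_dot_bracket_cyclic bracket_zero)
  finally show "(?p + ?q + ?r) + (?p + ?q + ?r) = 0" .
qed


section \<open>Lifting the identities to the tensor space\<close>

lemma tensor_double_cancel:
  fixes u w :: "nat fset \<Rightarrow>\<^sub>0 'v"
  assumes "u + u = w + w"
  shows "u = w"
proof (rule poly_mapping_eqI)
  fix S
  have "Poly_Mapping.lookup (u + u) S = Poly_Mapping.lookup (w + w) S"
    using assms by simp
  then have "(Poly_Mapping.lookup u S - Poly_Mapping.lookup w S) +
      (Poly_Mapping.lookup u S - Poly_Mapping.lookup w S) = 0"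
    by (simp add: lookup_add algebra_simps)
  from double_zero[OF this] show "Poly_Mapping.lookup u S = Poly_Mapping.lookup w S"
    by simp
qed

lemma tensor_triple_zero:
  fixes u :: "nat fset \<Rightarrow>\<^sub>0 'v"
  assumes "u + u + u = 0"
  shows "u = 0"
proof (rule poly_mapping_eqI)
  fix S
  have "Poly_Mapping.lookup (u + u + u) S = 0"
    using assms by simp
  then have "Poly_Mapping.lookup u S = 0"
    unfolding lookup_add by (rule triple_zero)
  then show "Poly_Mapping.lookup u S = Poly_Mapping.lookup 0 S"
    by simp
qed

abbreviation tdot (infixl "\<odot>" 70) where
  "u \<odot> w \<equiv> tensor_mult scale dot u w"

abbreviation tbracket ("\<lbrace>_, _\<rbrace>") where
  "\<lbrace>u, w\<rbrace> \<equiv> tensor_mult scale bracket u w"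

lemmas tdot_add = tensor_mult_add_left[OF dot_algebra] tensor_mult_add_right[OF dot_algebra]
lemmas tbracket_add =
  tensor_mult_add_left[OF bracket_algebra] tensor_mult_add_right[OF bracket_algebra]
lemmas tdot_single = tensor_mult_single[OF dot_algebra]
lemmas tbracket_single = tensor_mult_single[OF bracket_algebra]
lemmas tdot_homogeneous = homogeneous_tensor_mult[OF dot_algebra]
lemmas tbracket_homogeneous = homogeneous_tensor_mult[OF bracket_algebra]

lemma tdot_assoc: "u \<odot> v \<odot> w = u \<odot> (v \<odot> w)"
proof -
  have "u \<odot> v \<odot> w - u \<odot> (v \<odot> w) = 0"
  proof (rule triadditive_zero[of "\<lambda>u v w. u \<odot> v \<odot> w - u \<odot> (v \<odot> w)"])
    fix S T U and a b c :: 'v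
    have "grassmann_sign (S |\<union>| T) U * grassmann_sign S T =
        (grassmann_sign S (T |\<union>| U) * grassmann_sign T U :: 'f)"
      using grassmann_sign_cocycle[of S T U, where 'f = 'f] by (simp add: mult.commute)
    then show "Poly_Mapping.single S a \<odot> Poly_Mapping.single T b \<odot> Poly_Mapping.single U c -
        Poly_Mapping.single S a \<odot> (Poly_Mapping.single T b \<odot> Poly_Mapping.single U c) = 0"
      by (simp add: tdot_single dot_scale assoc sup_assoc)
  qed (simp_all add: tdot_add algebra_simps)
  then show ?thesis by simp
qed

text \<open>Even monomials commute with every monomial, so the parity of \<open>u\<close> alone
  decides.\<close>

lemma tdot_commute:
  assumes "homogeneous True u"
  shows "u \<odot> w = w \<odot> u"
proof -
  have "u \<odot> w - w \<odot> u = 0"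
    by (rule biadditive_zero[of "\<lambda>u w. u \<odot> w - w \<odot> u"])
      (use assms in \<open>auto simp: tdot_add algebra_simps homogeneous_def tdot_single
        grassmann_sign_even commute sup_commute\<close>)
  then show ?thesis by simp
qed

text \<open>The sign from exchanging two odd monomials cancels the sign of the anticommutative
  bracket.\<close>

lemma tbracket_commute:
  assumes "homogeneous False u" "homogeneous False w"
  shows "\<lbrace>u, w\<rbrace> = \<lbrace>w, u\<rbrace>"
proof -
  have "\<lbrace>u, w\<rbrace> - \<lbrace>w, u\<rbrace> = 0"
  proof (rule biadditive_zero[of "\<lambda>u w. \<lbrace>u, w\<rbrace> - \<lbrace>w, u\<rbrace>"])
    fix S T and a b :: 'v
    assume "S \<in> Poly_Mapping.keys u" "T \<in> Poly_Mapping.keys w"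
    then have "grassmann_sign T S = (- grassmann_sign S T :: 'f)"
      using assms by (intro grassmann_sign_odd) (auto simp: homogeneous_def)
    then show "\<lbrace>Poly_Mapping.single S a, Poly_Mapping.single T b\<rbrace> -
        \<lbrace>Poly_Mapping.single T b, Poly_Mapping.single S a\<rbrace> = 0"
      by (simp add: tbracket_single bracket_anticommute[of b a] sup_commute)
  qed (simp_all add: tbracket_add algebra_simps)
  then show ?thesis by simp
qed

text \<open>Only the last term moves the monomial of \<open>z\<close>, past that of
  \<open>x\<close>, and this costs no sign because it is even. So all terms on basis tensors carry
  the coefficient of \<open>e_S (e_T e_U)\<close>, and the rule in the algebra applies to what
  remains.\<close>

lemma tensor_leibniz:
  assumes "homogeneous True z"
  shows "z \<odot> \<lbrace>x, y\<rbrace> + z \<odot> \<lbrace>x, y\<rbrace> = \<lbrace>z \<odot> x, y\<rbrace> + \<lbrace>x, z \<odot> y\<rbrace>"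
proof -
  let ?F = "\<lambda>z x y. \<lbrace>z \<odot> x, y\<rbrace> + \<lbrace>x, z \<odot> y\<rbrace> - (z \<odot> \<lbrace>x, y\<rbrace> + z \<odot> \<lbrace>x, y\<rbrace>)"
  have "?F z x y = 0"
  proof (rule triadditive_zero[of ?F])
    fix S T U and a b c :: 'v
    assume "S \<in> Poly_Mapping.keys z"
    then have S: "even (fcard S)"
      using assms by (auto simp: homogeneous_def)
    have l: "grassmann_sign (S |\<union>| T) U * grassmann_sign S T =
        (grassmann_sign S (T |\<union>| U) * grassmann_sign T U :: 'f)"
      using grassmann_sign_cocycle[of S T U, where 'f = 'f] by (simp add: mult.commute)
    have r: "grassmann_sign T (S |\<union>| U) * grassmann_sign S U =
        (grassmann_sign S (T |\<union>| U) * grassmann_sign T U :: 'f)"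
      using grassmann_sign_cocycle[of T S U, where 'f = 'f] l
      unfolding grassmann_sign_even[OF S, of T] sup_commute[of T S] by (simp add: mult.commute)
    have sets: "S |\<union>| T |\<union>| U = S |\<union>| (T |\<union>| U)" "T |\<union>| (S |\<union>| U) = S |\<union>| (T |\<union>| U)"
      by auto
    show "?F (Poly_Mapping.single S a) (Poly_Mapping.single T b) (Poly_Mapping.single U c) = 0"
      unfolding tdot_single tbracket_single dot_scale bracket_scale scale_scale l r sets
        single_add[symmetric] scale_right_distrib[symmetric] leibniz by simp
  qed (simp_all add: tdot_add tbracket_add algebra_simps)
  then show ?thesis by simp
qed

text \<open>The three cyclic arrangements of odd monomials have the same sign \<open>s\<close> and
  the same union, so \<open>s\<close> factors out and \<open>dot_bracket_cyclic\<close>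
  finishes.\<close>

lemma tensor_dot_bracket_cyclic:
  assumes "homogeneous False x" "homogeneous False y" "homogeneous False z"
  shows "x \<odot> \<lbrace>y, z\<rbrace> + y \<odot> \<lbrace>z, x\<rbrace> + z \<odot> \<lbrace>x, y\<rbrace> = 0"
proof (rule triadditive_zero[of "\<lambda>x y z. x \<odot> \<lbrace>y, z\<rbrace> + y \<odot> \<lbrace>z, x\<rbrace> + z \<odot> \<lbrace>x, y\<rbrace>"])
  fix S T U and a b c :: 'v
  assume keys: "S \<in> Poly_Mapping.keys x" "T \<in> Poly_Mapping.keys y" "U \<in> Poly_Mapping.keys z"
  then have odds: "odd (fcard S)" "odd (fcard T)" "odd (fcard U)"
    using assms by (auto simp: homogeneous_def)
  define s :: 'f where "s = grassmann_sign S (T |\<union>| U) * grassmann_sign T U"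
  have s: "grassmann_sign S (T |\<union>| U) * grassmann_sign T U = s"
    "grassmann_sign T (U |\<union>| S) * grassmann_sign U S = s"
    "grassmann_sign U (S |\<union>| T) * grassmann_sign S T = s"
    using grassmann_sign_cyclic[OF odds, where 'f = 'f]
      grassmann_sign_cyclic[OF odds(2,3,1), where 'f = 'f] by (simp_all add: s_def mult.commute)
  have sets: "T |\<union>| (U |\<union>| S) = S |\<union>| (T |\<union>| U)" "U |\<union>| (S |\<union>| T) = S |\<union>| (T |\<union>| U)"
    by auto
  show "Poly_Mapping.single S a \<odot> \<lbrace>Poly_Mapping.single T b, Poly_Mapping.single U c\<rbrace> +
      Poly_Mapping.single T b \<odot> \<lbrace>Poly_Mapping.single U c, Poly_Mapping.single S a\<rbrace> +
      Poly_Mapping.single U c \<odot> \<lbrace>Poly_Mapping.single S a, Poly_Mapping.single T b\<rbrace> = 0"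
    unfolding tdot_single tbracket_single dot_scale scale_scale s sets
      single_add[symmetric] scale_right_distrib[symmetric] dot_bracket_cyclic by simp
qed (simp_all add: tdot_add tbracket_add algebra_simps)

text \<open>The monomial of \<open>h\<close> stays in front in every term, while the other three odd
  monomials rotate without a sign. Hence all terms share one coefficient \<open>s\<close> and
  \<open>bracket_bracket_cyclic\<close> applies.\<close>

lemma tensor_bracket_bracket_cyclic:
  assumes "homogeneous False x" "homogeneous False y" "homogeneous False z"
  shows "\<lbrace>h, x\<rbrace> \<odot> \<lbrace>y, z\<rbrace> + \<lbrace>h, y\<rbrace> \<odot> \<lbrace>z, x\<rbrace> + \<lbrace>h, z\<rbrace> \<odot> \<lbrace>x, y\<rbrace> = 0"
proof (rule tetraadditive_zero[of
      "\<lambda>h x y z. \<lbrace>h, x\<rbrace> \<odot> \<lbrace>y, z\<rbrace> + \<lbrace>h, y\<rbrace> \<odot> \<lbrace>z, x\<rbrace> + \<lbrace>h, z\<rbrace> \<odot> \<lbrace>x, y\<rbrace>"])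
  fix R S T U and d a b c :: 'v
  assume keys: "S \<in> Poly_Mapping.keys x" "T \<in> Poly_Mapping.keys y" "U \<in> Poly_Mapping.keys z"
  then have odds: "odd (fcard S)" "odd (fcard T)" "odd (fcard U)"
    using assms by (auto simp: homogeneous_def)
  define s :: 'f where
    "s = grassmann_sign R (S |\<union>| (T |\<union>| U)) * (grassmann_sign S (T |\<union>| U) * grassmann_sign T U)"
  have sets: "T |\<union>| (U |\<union>| S) = S |\<union>| (T |\<union>| U)" "U |\<union>| (S |\<union>| T) = S |\<union>| (T |\<union>| U)"
    "R |\<union>| S |\<union>| (T |\<union>| U) = R |\<union>| (S |\<union>| (T |\<union>| U))"
    "R |\<union>| T |\<union>| (U |\<union>| S) = R |\<union>| (S |\<union>| (T |\<union>| U))"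
    "R |\<union>| U |\<union>| (S |\<union>| T) = R |\<union>| (S |\<union>| (T |\<union>| U))"
    by auto
  \<comment> \<open>Regroups \<open>(e_R e_S)(e_T e_U)\<close> as
    \<open>e_R (e_S (e_T e_U))\<close>. It is stated for all \<open>S\<close>, \<open>T\<close>,
    \<open>U\<close> so that it also serves the rotated terms.\<close>
  have expand: "grassmann_sign (R |\<union>| S) (T |\<union>| U) * (grassmann_sign R S * grassmann_sign T U) =
      (grassmann_sign R (S |\<union>| (T |\<union>| U)) * (grassmann_sign S (T |\<union>| U) * grassmann_sign T U) :: 'f)"
    for S T U
    using arg_cong[OF grassmann_sign_cocycle[of R S "T |\<union>| U", where 'f = 'f],
        of "\<lambda>t. t * grassmann_sign T U"] by (simp add: ac_simps)
  have cyc: "grassmann_sign T (U |\<union>| S) * grassmann_sign U S =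
      (grassmann_sign S (T |\<union>| U) * grassmann_sign T U :: 'f)"
    "grassmann_sign U (S |\<union>| T) * grassmann_sign S T =
      (grassmann_sign S (T |\<union>| U) * grassmann_sign T U :: 'f)"
    using grassmann_sign_cyclic[OF odds, where 'f = 'f]
      grassmann_sign_cyclic[OF odds(2,3,1), where 'f = 'f] by (simp_all add: mult.commute)
  have s: "grassmann_sign (R |\<union>| S) (T |\<union>| U) * (grassmann_sign R S * grassmann_sign T U) = s"
    "grassmann_sign (R |\<union>| T) (U |\<union>| S) * (grassmann_sign R T * grassmann_sign U S) = s"
    "grassmann_sign (R |\<union>| U) (S |\<union>| T) * (grassmann_sign R U * grassmann_sign S T) = s"
    unfolding expand cyc sets s_def by simp_all
  have prod: "\<lbrace>Poly_Mapping.single R d, Poly_Mapping.single S a\<rbrace> \<odot>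
        \<lbrace>Poly_Mapping.single T b, Poly_Mapping.single U c\<rbrace> =
      Poly_Mapping.single (R |\<union>| S |\<union>| (T |\<union>| U))
        (scale (grassmann_sign (R |\<union>| S) (T |\<union>| U) * (grassmann_sign R S * grassmann_sign T U))
          (dot (bracket d a) (bracket b c)))" for S T U a b c
    by (simp add: tdot_single tbracket_single dot_scale ac_simps)
  show "\<lbrace>Poly_Mapping.single R d, Poly_Mapping.single S a\<rbrace> \<odot>
        \<lbrace>Poly_Mapping.single T b, Poly_Mapping.single U c\<rbrace> +
      \<lbrace>Poly_Mapping.single R d, Poly_Mapping.single T b\<rbrace> \<odot>
        \<lbrace>Poly_Mapping.single U c, Poly_Mapping.single S a\<rbrace> +
      \<lbrace>Poly_Mapping.single R d, Poly_Mapping.single U c\<rbrace> \<odot>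
        \<lbrace>Poly_Mapping.single S a, Poly_Mapping.single T b\<rbrace> = 0"
    unfolding prod s sets(3-5)
    unfolding single_add[symmetric] scale_right_distrib[symmetric] bracket_bracket_cyclic
    by simp
qed (simp_all only: tdot_add tbracket_add ac_simps)

section \<open>Consequences for even and odd elements, up to the Jordan identity\<close>

lemmas tdot_even_even = tdot_homogeneous[of True _ True, simplified]
lemmas tdot_even_odd = tdot_homogeneous[of True _ False, simplified]
lemmas tdot_odd_even = tdot_homogeneous[of False _ True, simplified]
lemmas tbracket_odd_odd = tbracket_homogeneous[of False _ False, simplified]

lemma tdot_left_commute:
  assumes "homogeneous True u"
  shows "v \<odot> (u \<odot> w) = u \<odot> (v \<odot> w)"
  by (metis assms tdot_assoc tdot_commute)

text \<open>For equal arguments the two brackets in the Leibniz rule coincide by symmetry, so the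
  factor 2 cancels.\<close>

lemma bracket_even_multiple:
  assumes a: "homogeneous True a" and b: "homogeneous False b"
  shows "\<lbrace>a \<odot> b, b\<rbrace> = a \<odot> \<lbrace>b, b\<rbrace>"
proof (rule tensor_double_cancel)
  show "\<lbrace>a \<odot> b, b\<rbrace> + \<lbrace>a \<odot> b, b\<rbrace> = a \<odot> \<lbrace>b, b\<rbrace> + a \<odot> \<lbrace>b, b\<rbrace>"
    unfolding tensor_leibniz[OF a] tbracket_commute[OF b tdot_even_odd[OF a b]] ..
qed

text \<open>Let X = aa{b,d} and Y = {ab,ad}. Applying the Leibniz rule for \<open>a\<close> twice to
  X gives 4X = 2Y + {aab,d} + {b,aad}, and the rule for the multiplier \<open>aa\<close> identifies
  the last two terms with 2X. Hence 2Y = 2X.\<close>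

lemma bracket_even_multiples:
  assumes a: "homogeneous True a" and b: "homogeneous False b" and d: "homogeneous False d"
  shows "\<lbrace>a \<odot> b, a \<odot> d\<rbrace> = a \<odot> a \<odot> \<lbrace>b, d\<rbrace>"
proof (rule tensor_double_cancel)
  have 1: "a \<odot> \<lbrace>b, a \<odot> d\<rbrace> + a \<odot> \<lbrace>b, a \<odot> d\<rbrace> = \<lbrace>a \<odot> b, a \<odot> d\<rbrace> + \<lbrace>b, a \<odot> a \<odot> d\<rbrace>"
    using tensor_leibniz[OF a] by (simp add: tdot_assoc)
  have 2: "a \<odot> \<lbrace>a \<odot> b, d\<rbrace> + a \<odot> \<lbrace>a \<odot> b, d\<rbrace> = \<lbrace>a \<odot> a \<odot> b, d\<rbrace> + \<lbrace>a \<odot> b, a \<odot> d\<rbrace>"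
    using tensor_leibniz[OF a] by (simp add: tdot_assoc)
  have 3: "a \<odot> a \<odot> \<lbrace>b, d\<rbrace> + a \<odot> a \<odot> \<lbrace>b, d\<rbrace> = \<lbrace>a \<odot> a \<odot> b, d\<rbrace> + \<lbrace>b, a \<odot> a \<odot> d\<rbrace>"
    by (rule tensor_leibniz[OF tdot_even_even[OF a a]])
  have "a \<odot> a \<odot> \<lbrace>b, d\<rbrace> + a \<odot> a \<odot> \<lbrace>b, d\<rbrace> = a \<odot> (a \<odot> \<lbrace>b, d\<rbrace> + a \<odot> \<lbrace>b, d\<rbrace>)"
    by (simp add: tdot_add tdot_assoc)
  also have "\<dots> = a \<odot> \<lbrace>a \<odot> b, d\<rbrace> + a \<odot> \<lbrace>b, a \<odot> d\<rbrace>"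
    by (simp add: tensor_leibniz[OF a] tdot_add)
  finally have 4: "a \<odot> a \<odot> \<lbrace>b, d\<rbrace> + a \<odot> a \<odot> \<lbrace>b, d\<rbrace> = a \<odot> \<lbrace>a \<odot> b, d\<rbrace> + a \<odot> \<lbrace>b, a \<odot> d\<rbrace>" .
  let ?X = "a \<odot> a \<odot> \<lbrace>b, d\<rbrace>" and ?Y = "\<lbrace>a \<odot> b, a \<odot> d\<rbrace>"
  have "(?X + ?X) + (?X + ?X) =
      (a \<odot> \<lbrace>a \<odot> b, d\<rbrace> + a \<odot> \<lbrace>a \<odot> b, d\<rbrace>) + (a \<odot> \<lbrace>b, a \<odot> d\<rbrace> + a \<odot> \<lbrace>b, a \<odot> d\<rbrace>)"
    unfolding 4 by (simp add: ac_simps)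
  also have "\<dots> = (?Y + ?Y) + (\<lbrace>a \<odot> a \<odot> b, d\<rbrace> + \<lbrace>b, a \<odot> a \<odot> d\<rbrace>)"
    unfolding 1 2 by (simp add: ac_simps)
  also have "\<dots> = (?Y + ?Y) + (?X + ?X)"
    unfolding 3 ..
  finally show "?Y + ?Y = ?X + ?X"
    by (simp only: add_right_cancel)
qed

lemma odd_cube:
  assumes b: "homogeneous False b"
  shows "b \<odot> \<lbrace>b, b\<rbrace> = 0"
  using tensor_dot_bracket_cyclic[OF b b b] by (rule tensor_triple_zero)

lemma bracket_square_orthogonal:
  assumes b: "homogeneous False b"
  shows "\<lbrace>d, b\<rbrace> \<odot> \<lbrace>b, b\<rbrace> = 0"
  using tensor_bracket_bracket_cyclic[OF b b b] by (rule tensor_triple_zero)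

text \<open>The even element {b,b} is used as the multiplier: 2{b,b}{d,b} = {{b,b}d,b} + {d,{b,b}b}.
  The left side vanishes by \<open>bracket_square_orthogonal\<close> and the last bracket by
  \<open>odd_cube\<close>.\<close>

lemma bracket_square_multiple:
  assumes b: "homogeneous False b"
  shows "\<lbrace>\<lbrace>b, b\<rbrace> \<odot> d, b\<rbrace> = 0"
proof -
  have even: "homogeneous True \<lbrace>b, b\<rbrace>"
    by (rule tbracket_odd_odd[OF b b])
  have "\<lbrace>b, b\<rbrace> \<odot> \<lbrace>d, b\<rbrace> = 0" "\<lbrace>b, b\<rbrace> \<odot> b = 0"
    by (simp_all add: tdot_commute[OF even] bracket_square_orthogonal[OF b] odd_cube[OF b])
  with tensor_leibniz[OF even, of d b] show ?thesis
    by (simp add: tensor_mult_zero)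
qed

text \<open>The cyclic identity for (ab, d, b) is compared with \<open>a\<close> times the one for
  (b, d, b). Both contain ab{d,b} and ad{b,b}, the latter because {b,ab} = a{b,b}; the remaining
  terms must agree.\<close>

lemma odd_times_bracket:
  assumes a: "homogeneous True a" and b: "homogeneous False b" and d: "homogeneous False d"
  shows "\<lbrace>a \<odot> b, d\<rbrace> \<odot> b = a \<odot> b \<odot> \<lbrace>d, b\<rbrace>"
proof -
  have ab: "homogeneous False (a \<odot> b)"
    by (rule tdot_even_odd[OF a b])
  have 1: "a \<odot> b \<odot> \<lbrace>d, b\<rbrace> + d \<odot> \<lbrace>b, a \<odot> b\<rbrace> + b \<odot> \<lbrace>a \<odot> b, d\<rbrace> = 0"
    by (rule tensor_dot_bracket_cyclic[OF ab d b])
  have "b \<odot> \<lbrace>d, b\<rbrace> + d \<odot> \<lbrace>b, b\<rbrace> + b \<odot> \<lbrace>b, d\<rbrace> = 0"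
    by (rule tensor_dot_bracket_cyclic[OF b d b])
  then have "a \<odot> (b \<odot> \<lbrace>d, b\<rbrace> + d \<odot> \<lbrace>b, b\<rbrace> + b \<odot> \<lbrace>b, d\<rbrace>) = 0"
    by (simp add: tensor_mult_zero)
  then have 2: "a \<odot> b \<odot> \<lbrace>d, b\<rbrace> + a \<odot> (d \<odot> \<lbrace>b, b\<rbrace>) + a \<odot> b \<odot> \<lbrace>d, b\<rbrace> = 0"
    by (simp add: tdot_add tdot_assoc tbracket_commute[OF b d])
  have "d \<odot> \<lbrace>b, a \<odot> b\<rbrace> = a \<odot> (d \<odot> \<lbrace>b, b\<rbrace>)"
    by (simp add: tbracket_commute[OF b ab] bracket_even_multiple[OF a b] tdot_left_commute[OF a])
  with 1 2 have "b \<odot> \<lbrace>a \<odot> b, d\<rbrace> = a \<odot> b \<odot> \<lbrace>d, b\<rbrace>"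
    by (metis add_left_cancel)
  then show ?thesis
    by (simp add: tdot_commute[OF tbracket_odd_odd[OF ab d]])
qed

text \<open>With u = a + bx and v = c + dx, the square of u is p + qx, and the claim is the even
  coordinate of (uu v)u = uu(vu). The term pca is common to both sides; the rest splits into terms
  in \<open>d\<close> (fact 7) and terms in \<open>c\<close> (fact 4).\<close>

lemma tensor_jordan_even:
  assumes a: "homogeneous True a" and c: "homogeneous True c"
    and b: "homogeneous False b" and d: "homogeneous False d"
  defines "p \<equiv> a \<odot> a + \<lbrace>b, b\<rbrace>" and "q \<equiv> a \<odot> b + b \<odot> a"
  shows "(p \<odot> c + \<lbrace>q, d\<rbrace>) \<odot> a + \<lbrace>p \<odot> d + q \<odot> c, b\<rbrace> =
    p \<odot> (c \<odot> a + \<lbrace>d, b\<rbrace>) + \<lbrace>q, c \<odot> b + d \<odot> a\<rbrace>"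
proof -
  have ab: "homogeneous False (a \<odot> b)" and ad: "homogeneous False (a \<odot> d)"
    and cb: "homogeneous False (c \<odot> b)" and ac: "homogeneous True (a \<odot> c)"
    by (simp_all add: tdot_even_odd tdot_even_even a b c d)
  have q: "q = a \<odot> b + a \<odot> b"
    by (simp add: q_def tdot_commute[OF a])
  have "\<lbrace>q, d\<rbrace> \<odot> a = a \<odot> \<lbrace>a \<odot> b, d\<rbrace> + a \<odot> \<lbrace>a \<odot> b, d\<rbrace>"
    by (simp add: q tbracket_add tdot_add tdot_commute[OF a])
  then have 1: "\<lbrace>q, d\<rbrace> \<odot> a = \<lbrace>a \<odot> a \<odot> b, d\<rbrace> + \<lbrace>a \<odot> b, a \<odot> d\<rbrace>"
    by (simp add: tensor_leibniz[OF a] tdot_assoc)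
  \<comment> \<open>The summand {b,b} of \<open>p\<close> contributes nothing here, by
    \<open>bracket_square_multiple\<close>.\<close>
  have 2: "\<lbrace>p \<odot> d, b\<rbrace> = \<lbrace>b, a \<odot> a \<odot> d\<rbrace>"
    using tbracket_commute[OF b tdot_even_odd[OF tdot_even_even[OF a a] d]]
    by (simp add: p_def tdot_add tbracket_add bracket_square_multiple[OF b])
  \<comment> \<open>The Leibniz rule for \<open>a\<close> on {b,cb} yields two copies of a{b,cb}.
    One of them equals {b,acb}, since both are ac{b,b}; the other is therefore {ab,cb}.\<close>
  have "\<lbrace>a \<odot> b, c \<odot> b\<rbrace> + \<lbrace>b, a \<odot> c \<odot> b\<rbrace> = a \<odot> \<lbrace>b, c \<odot> b\<rbrace> + a \<odot> \<lbrace>b, c \<odot> b\<rbrace>"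
    by (simp add: tensor_leibniz[OF a] tdot_assoc)
  moreover have "\<lbrace>b, a \<odot> c \<odot> b\<rbrace> = a \<odot> \<lbrace>b, c \<odot> b\<rbrace>"
    using bracket_even_multiple[OF ac b] bracket_even_multiple[OF c b]
    unfolding tbracket_commute[OF b cb] tbracket_commute[OF b tdot_even_odd[OF ac b]]
    by (simp add: tdot_assoc)
  ultimately have 3: "\<lbrace>a \<odot> c \<odot> b, b\<rbrace> = \<lbrace>a \<odot> b, c \<odot> b\<rbrace>"
    using tbracket_commute[OF b tdot_even_odd[OF ac b]] by simp
  have "a \<odot> b \<odot> c = a \<odot> c \<odot> b"
    by (simp add: tdot_assoc tdot_commute[OF c])
  then have 4: "\<lbrace>q \<odot> c, b\<rbrace> = \<lbrace>q, c \<odot> b\<rbrace>"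
    by (simp add: q tdot_add tbracket_add 3)
  have 5: "\<lbrace>q, d \<odot> a\<rbrace> = \<lbrace>a \<odot> b, a \<odot> d\<rbrace> + \<lbrace>a \<odot> b, a \<odot> d\<rbrace>"
    by (simp add: q tbracket_add tdot_commute[OF a])
  have 6: "p \<odot> \<lbrace>d, b\<rbrace> = a \<odot> a \<odot> \<lbrace>b, d\<rbrace>"
    using bracket_square_orthogonal[OF b, of d]
    by (simp add: p_def tdot_add tdot_commute[OF tbracket_odd_odd[OF b b]] tbracket_commute[OF d b])
  \<comment> \<open>By the Leibniz rule for \<open>aa\<close> the parenthesis is 2aa{b,d}, and by
    \<open>bracket_even_multiples\<close> {ab,ad} is aa{b,d}. So both sides of fact 7 equal
    3aa{b,d}.\<close>
  have "\<lbrace>q, d\<rbrace> \<odot> a + \<lbrace>p \<odot> d, b\<rbrace> =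
      (\<lbrace>a \<odot> a \<odot> b, d\<rbrace> + \<lbrace>b, a \<odot> a \<odot> d\<rbrace>) + \<lbrace>a \<odot> b, a \<odot> d\<rbrace>"
    unfolding 1 2 by (simp add: ac_simps)
  then have 7: "\<lbrace>q, d\<rbrace> \<odot> a + \<lbrace>p \<odot> d, b\<rbrace> = p \<odot> \<lbrace>d, b\<rbrace> + \<lbrace>q, d \<odot> a\<rbrace>"
    unfolding tensor_leibniz[OF tdot_even_even[OF a a], symmetric] 5 6
      bracket_even_multiples[OF a b d] by (simp add: ac_simps)
  have "(p \<odot> c + \<lbrace>q, d\<rbrace>) \<odot> a + \<lbrace>p \<odot> d + q \<odot> c, b\<rbrace> =
      p \<odot> (c \<odot> a) + (\<lbrace>q, d\<rbrace> \<odot> a + \<lbrace>p \<odot> d, b\<rbrace>) + \<lbrace>q \<odot> c, b\<rbrace>"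
    by (simp only: tdot_add tbracket_add tdot_assoc add.assoc)
  also have "\<dots> = p \<odot> (c \<odot> a + \<lbrace>d, b\<rbrace>) + \<lbrace>q, c \<odot> b + d \<odot> a\<rbrace>"
    unfolding 7 4 by (simp add: tdot_add tbracket_add ac_simps)
  finally show ?thesis .
qed

text \<open>This is the odd coordinate of the same Jordan identity. All terms match by associativity
  except {q,d}b and q{d,b}, where q = 2ab, and these agree by
  \<open>odd_times_bracket\<close>.\<close>

lemma tensor_jordan_odd:
  assumes a: "homogeneous True a" and c: "homogeneous True c"
    and b: "homogeneous False b" and d: "homogeneous False d"
  defines "p \<equiv> a \<odot> a + \<lbrace>b, b\<rbrace>" and "q \<equiv> a \<odot> b + b \<odot> a"
  shows "(p \<odot> c + \<lbrace>q, d\<rbrace>) \<odot> b + (p \<odot> d + q \<odot> c) \<odot> a =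
    p \<odot> (c \<odot> b + d \<odot> a) + q \<odot> (c \<odot> a + \<lbrace>d, b\<rbrace>)"
proof -
  have "\<lbrace>q, d\<rbrace> \<odot> b = q \<odot> \<lbrace>d, b\<rbrace>"
    using odd_times_bracket[OF a b d]
    by (simp add: q_def tdot_commute[OF a, of b, symmetric] tdot_add tbracket_add)
  then show ?thesis
    by (simp add: tdot_add tdot_assoc ac_simps)
qed

end


section \<open>The Grassmann envelope of the Kantor double\<close>

text \<open>A family of pairs is read as a + bx with two families a and b. Even and odd refer here
  to the grading of the Kantor double; the Grassmann parity of the coordinates is a separate
  condition.\<close>

abbreviation even_coord :: "(nat fset \<Rightarrow>\<^sub>0 'v::ab_group_add \<times> 'v) \<Rightarrow> nat fset \<Rightarrow>\<^sub>0 'v" where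
  "even_coord \<equiv> Poly_Mapping.map fst"

abbreviation odd_coord :: "(nat fset \<Rightarrow>\<^sub>0 'v::ab_group_add \<times> 'v) \<Rightarrow> nat fset \<Rightarrow>\<^sub>0 'v" where
  "odd_coord \<equiv> Poly_Mapping.map snd"

lemma lookup_coord:
  "Poly_Mapping.lookup (even_coord u) S = fst (Poly_Mapping.lookup u S)"
  "Poly_Mapping.lookup (odd_coord u) S = snd (Poly_Mapping.lookup u S)"
  by (simp_all add: Poly_Mapping.map.rep_eq when_def)

lemma coord_eqI:
  "\<lbrakk>even_coord u = even_coord w; odd_coord u = odd_coord w\<rbrakk> \<Longrightarrow> u = w"
  by (intro poly_mapping_eqI prod_eqI) (simp_all flip: lookup_coord)

lemma coord_add:
  "even_coord (u + w) = even_coord u + even_coord w"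
  "odd_coord (u + w) = odd_coord u + odd_coord w"
  by (auto intro!: poly_mapping_eqI simp: lookup_coord lookup_add)

lemma coord_zero: "even_coord 0 = 0" "odd_coord 0 = 0"
  by (auto intro!: poly_mapping_eqI simp: lookup_coord)

lemma coord_single:
  "even_coord (Poly_Mapping.single S v) = Poly_Mapping.single S (fst v)"
  "odd_coord (Poly_Mapping.single S v) = Poly_Mapping.single S (snd v)"
  by (auto intro!: poly_mapping_eqI simp: lookup_coord lookup_single when_def)

text \<open>By \<open>tensor_subspace_lookup\<close> membership in each summand is a condition on
  single coefficients: at even sets only the first component may be nonzero, at odd sets only the
  second.\<close>

lemma grassmann_envelope_kantor:
  fixes scale :: "'f::field \<Rightarrow> 'a::ab_group_add \<Rightarrow> 'a"
  assumes "vector_space (kantor_scale scale)"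
  shows "u \<in> grassmann_envelope (kantor_scale scale) kantor_even kantor_odd \<longleftrightarrow>
    homogeneous True (even_coord u) \<and> homogeneous False (odd_coord u)"
proof -
  interpret vector_space "kantor_scale scale" by fact
  have subspaces: "subspace kantor_even" "subspace kantor_odd"
    by (auto simp: subspace_def kantor_even_def kantor_odd_def kantor_scale_def zero_prod_def
        intro: scale_zero_right[unfolded kantor_scale_def zero_prod_def, simplified])
  note mem = tensor_subspace_lookup[OF subspaces(1), of _ "\<lambda>S. even (fcard S)", folded grassmann_even_def]
    tensor_subspace_lookup[OF subspaces(2), of _ "\<lambda>S. odd (fcard S)", folded grassmann_odd_def]
  have hom: "homogeneous e v \<longleftrightarrow> (\<forall>S. even (fcard S) \<noteq> e \<longrightarrow> Poly_Mapping.lookup v S = 0)"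
    for e and v :: "nat fset \<Rightarrow>\<^sub>0 'a"
    by (auto simp: homogeneous_def in_keys_iff)
  show ?thesis
  proof
    assume "u \<in> grassmann_envelope (kantor_scale scale) kantor_even kantor_odd"
    then obtain p q where u: "u = p + q"
      and "p \<in> tensor_subspace (kantor_scale scale) grassmann_even kantor_even"
      and "q \<in> tensor_subspace (kantor_scale scale) grassmann_odd kantor_odd"
      by (auto simp: grassmann_envelope_def)
    then show "homogeneous True (even_coord u) \<and> homogeneous False (odd_coord u)"
      unfolding mem u hom
      by (auto simp: lookup_coord lookup_add kantor_even_def kantor_odd_def mem_Times_iff)
  next
    assume u: "homogeneous True (even_coord u) \<and> homogeneous False (odd_coord u)"
    \<comment> \<open>Splitting \<open>u\<close> by the parity of \<open>S\<close> also separates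
      the two coordinates, since the hypothesis makes the odd coordinate vanish at even sets and the
      even coordinate at odd sets.\<close>
    define p where "p = Poly_Mapping.mapp (\<lambda>S v. if even (fcard S) then v else 0) u"
    define q where "q = Poly_Mapping.mapp (\<lambda>S v. if even (fcard S) then 0 else v) u"
    have lookup: "Poly_Mapping.lookup p S = (if even (fcard S) then Poly_Mapping.lookup u S else 0)"
      "Poly_Mapping.lookup q S = (if even (fcard S) then 0 else Poly_Mapping.lookup u S)" for S
      by (simp_all add: p_def q_def mapp.rep_eq when_def in_keys_iff)
    have "u = p + q"
      by (rule poly_mapping_eqI) (simp add: lookup_add lookup)
    moreover have "p \<in> tensor_subspace (kantor_scale scale) grassmann_even kantor_even"
      "q \<in> tensor_subspace (kantor_scale scale) grassmann_odd kantor_odd"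
      using u unfolding mem hom
      by (auto simp: lookup lookup_coord kantor_even_def kantor_odd_def mem_Times_iff)
    ultimately show "u \<in> grassmann_envelope (kantor_scale scale) kantor_even kantor_odd"
      unfolding grassmann_envelope_def by blast
  qed
qed

section \<open>The Kantor double as a Jordan superalgebra\<close>

context transposed_poisson_algebra_char_0
begin

lemma kantor_algebra: "algebra_on (kantor_scale scale) UNIV (kantor_mult dot bracket)"
proof -
  interpret K: vector_space "kantor_scale scale"
    by unfold_locales (auto simp: kantor_scale_def algebra_simps)
  show ?thesis
    by unfold_locales
      (auto simp: kantor_scale_def kantor_mult_def dot_add bracket_add dot_scale bracket_scale
        algebra_simps)
qed

text \<open>The Grassmann factors keep their order in a product, so the formula of the Kantor double
  carries over to the coordinates without signs.\<close>

lemma coord_tensor_mult: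
  "even_coord (tensor_mult (kantor_scale scale) (kantor_mult dot bracket) u w) =
    even_coord u \<odot> even_coord w + \<lbrace>odd_coord u, odd_coord w\<rbrace>" (is ?E)
  "odd_coord (tensor_mult (kantor_scale scale) (kantor_mult dot bracket) u w) =
    even_coord u \<odot> odd_coord w + odd_coord u \<odot> even_coord w" (is ?O)
proof -
  note simps = coord_add coord_single tensor_mult_add_left[OF kantor_algebra]
    tensor_mult_add_right[OF kantor_algebra] tensor_mult_single[OF kantor_algebra]
    tdot_add tbracket_add tdot_single tbracket_single
  have coords: "fst (kantor_scale scale r v) = scale r (fst v)"
    "snd (kantor_scale scale r v) = scale r (snd v)"
    "fst (kantor_mult dot bracket v v') = dot (fst v) (fst v') + bracket (snd v) (snd v')"
    "snd (kantor_mult dot bracket v v') = dot (fst v) (snd v') + dot (snd v) (fst v')" for r v v'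
    by (simp_all add: kantor_scale_def kantor_mult_def case_prod_beta)
  have "even_coord (tensor_mult (kantor_scale scale) (kantor_mult dot bracket) u w) -
      (even_coord u \<odot> even_coord w + \<lbrace>odd_coord u, odd_coord w\<rbrace>) = 0" (is "?F u w = 0")
    by (rule biadditive_zero[of ?F])
      (simp_all add: simps coords scale_right_distrib single_add)
  then show ?E by simp
  have "odd_coord (tensor_mult (kantor_scale scale) (kantor_mult dot bracket) u w) -
      (even_coord u \<odot> odd_coord w + odd_coord u \<odot> even_coord w) = 0" (is "?F u w = 0")
    by (rule biadditive_zero[of ?F])
      (simp_all add: simps coords scale_right_distrib single_add)
  then show ?O by simp
qed

lemma kantor_superalgebra:
  "superalgebra (kantor_scale scale) (kantor_mult dot bracket) kantor_even kantor_odd"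
proof -
  interpret K: algebra_on "kantor_scale scale" UNIV "kantor_mult dot bracket"
    by (rule kantor_algebra)
  show ?thesis
  proof
    fix x :: "'v \<times> 'v"
    show "\<exists>a\<in>kantor_even. \<exists>b\<in>kantor_odd. x = a + b"
      by (rule bexI[of _ "(fst x, 0)"], rule bexI[of _ "(0, snd x)"])
        (auto simp: kantor_even_def kantor_odd_def)
  qed (auto simp: K.subspace_def kantor_even_def kantor_odd_def kantor_scale_def kantor_mult_def
      zero_prod_def dot_zero bracket_zero)
qed

lemma kantor_envelope_jordan:
  "jordan_algebra_on (tensor_scale (kantor_scale scale))
    (grassmann_envelope (kantor_scale scale) kantor_even kantor_odd)
    (tensor_mult (kantor_scale scale) (kantor_mult dot bracket))"
    (is "jordan_algebra_on ?scale ?A ?mult")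
proof -
  interpret K: algebra_on "kantor_scale scale" UNIV "kantor_mult dot bracket"
    by (rule kantor_algebra)
  interpret T: vector_space ?scale
    by (rule K.vector_space_tensor)
  note mem = grassmann_envelope_kantor[OF K.vector_space_axioms]
  have scale_keys: "homogeneous True (even_coord (?scale r u)) \<and> homogeneous False (odd_coord (?scale r u))"
    if "homogeneous True (even_coord u)" "homogeneous False (odd_coord u)" for r u
    using that by (auto simp: homogeneous_def in_keys_iff lookup_coord K.lookup_tensor_scale
        kantor_scale_def case_prod_beta)
  show ?thesis
  proof
    show "T.subspace ?A"
      unfolding T.subspace_def using scale_keys by (auto simp: mem coord_zero coord_add homogeneous_add)
  next
    fix u w
    assume "u \<in> ?A" "w \<in> ?A"
    then show "?mult u w \<in> ?A"
      unfolding mem coord_tensor_mult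
      by (simp add: homogeneous_add tdot_even_even tdot_even_odd tdot_odd_even tbracket_odd_odd)
  next
    fix u w
    assume "u \<in> ?A" "w \<in> ?A"
    then have u: "homogeneous True (even_coord u)" "homogeneous False (odd_coord u)"
      and w: "homogeneous True (even_coord w)" "homogeneous False (odd_coord w)"
      by (simp_all add: mem)
    show "?mult u w = ?mult w u"
      by (rule coord_eqI) (simp_all add: coord_tensor_mult tdot_commute[OF u(1), of "even_coord w"]
          tdot_commute[OF u(1), of "odd_coord w"] tdot_commute[OF w(1), of "odd_coord u"]
          tbracket_commute[OF u(2) w(2)] add.commute)
    \<comment> \<open>In coordinates the two components are exactly
      \<open>tensor_jordan_even\<close> and \<open>tensor_jordan_odd\<close>, with \<open>a\<close>,
      \<open>b\<close> the coordinates of \<open>u\<close> and \<open>c\<close>, \<open>d\<close>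
      those of \<open>w\<close>.\<close>
    show "?mult (?mult (?mult u u) w) u = ?mult (?mult u u) (?mult w u)"
      by (rule coord_eqI; unfold coord_tensor_mult)
        (rule tensor_jordan_even tensor_jordan_odd; fact u w)+
  qed (simp_all add: tensor_mult_add_left[OF kantor_algebra] tensor_mult_add_right[OF kantor_algebra]
      tensor_mult_scale[OF kantor_algebra])
qed

end

theorem corollary26:
  fixes scale :: "complex \<Rightarrow> 'a::ab_group_add \<Rightarrow> 'a"
    and dot bracket :: "'a \<Rightarrow> 'a \<Rightarrow> 'a"
  assumes "transposed_poisson_algebra scale dot bracket"
  shows "jordan_superalgebra (kantor_scale scale) (kantor_mult dot bracket)
    kantor_even kantor_odd"
proof -
  interpret transposed_poisson_algebra_char_0 scale dot bracket
    using assms by (rule transposed_poisson_algebra_char_0.intro)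
  show ?thesis
    using kantor_superalgebra kantor_envelope_jordan
    by (simp add: jordan_superalgebra_def jordan_superalgebra_axioms_def)
qed

end
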